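(* Let $F=\mathbb{R}$ or $\mathbb{C}$. If $n\geq 3$ and $0\leq\alpha<1$, then $$\int_{[N_{n},N_{n}]}a_{n}(v)^{-\rho_{n}}\,a_{n}(v)^{\alpha\,(\dim_{\mathbb{R}}F)\,\Lambda_{n-1}}\,\bigl(1+\rho_{n}(\log a_{n}(v))\bigr)^{r}\,dv<\infty$$ for all $r\in\mathbb{R}$.
   Context: Let $G_n=SL(n,F)$, $K_n=SO(n)$ if $F=\mathbb{R}$ and $K_n=SU(n)$ if $F=\mathbb{C}$. $N_n$ is the group of upper triangular matrices in $G_n$ with ones on the main diagonal, $\bar N_n=N_n^T$ (lower triangular with ones on the diagonal), and $A_n$ is the group of diagonal matrices in $G_n$ with positive real entries. $G_n=\bar N_nA_nK_n$ is an Iwasawa decomposition; for $g\in G_n$ write uniquely $g=\bar n(g)\,a_n(g)\,k_n(g)$ with $\bar n(g)\in\bar N_n$, $a_n(g)\in A_n$, $k_n(g)\in K_n$. For $a=\mathrm{diag}(a_1,\dots,a_n)\in A_n$: $a^{\rho_n}=\bigl(\det \mathrm{Ad}(a)|_{\mathrm{Lie}(N_n)}\bigr)^{1/2}$ (determinant over $\mathbb{R}$), $a^{\Lambda_i}=a_1a_2\cdots a_i$ for $1\le i\le n-1$ ($\Lambda_i$ is the highest weight of $\wedge^iF^n$), $a^{c\mu}=(a^{\mu})^c$ for real $c$, and $\mu(\log a)=\log(a^{\mu})$ for a weight $\mu$. $[N_n,N_n]$ is the commutator subgroup of $N_n$ (the elements of $N_n$ whose first superdiagonal entries vanish) and $dv$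 is a Haar measure on it (Lebesgue measure in the free matrix entries). *)

theory Defs
  imports
    "HOL-Analysis.Analysis"
    "HOL-Algebra.Generated_Groups"
    "Jordan_Normal_Form.Schur_Decomposition"
begin

(* Matrices are those of Jordan_Normal_Form, with indices starting at 0.  The scalar type 'a is
   only ever meant to be real or complex; conjugate is the identity on real. *)

definition SL :: "nat \<Rightarrow> 'a::field mat monoid" where
  "SL n = \<lparr>carrier = {g \<in> carrier_mat n n. Determinant.det g = 1},
           monoid.mult = (*), one = 1\<^sub>m n\<rparr>"

(* For 'a = real this is SO(n). *)
definition SU :: "nat \<Rightarrow> 'a::conjugatable_field mat set" where
  "SU n = {k \<in> carrier (SL n). mat_adjoint k * k = 1\<^sub>m n}"

definition unip_upper :: "nat \<Rightarrow> 'a::field mat set" where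
  "unip_upper n = {v \<in> carrier (SL n). upper_triangular v \<and> (\<forall>i<n. v $$ (i, i) = 1)}"

definition unip_lower :: "nat \<Rightarrow> 'a::field mat set" where
  "unip_lower n = transpose_mat ` unip_upper n"

definition pos_diag :: "nat \<Rightarrow> 'a::real_normed_field mat set" where
  "pos_diag n = {a \<in> carrier (SL n). diagonal_mat a \<and> (\<forall>i<n. \<exists>x>0. a $$ (i, i) = of_real x)}"

definition iwasawa_a :: "nat \<Rightarrow> 'a::{conjugatable_field, real_normed_field} mat \<Rightarrow> 'a mat" where
  "iwasawa_a n g = (THE a. a \<in> pos_diag n \<and> (\<exists>m\<in>unip_lower n. \<exists>k\<in>SU n. g = m * a * k))"

(* Leibniz determinant of a square matrix indexed by an arbitrary finite set *)
definition det_over :: "'i set \<Rightarrow> ('i \<Rightarrow> 'i \<Rightarrow> 'b::comm_ring_1) \<Rightarrow> 'b" where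
  "det_over I M = (\<Sum>p | p permutes I. of_int (sign p) * (\<Prod>i\<in>I. M i (p i)))"

definition Ad :: "nat \<Rightarrow> 'a::field mat \<Rightarrow> 'a mat \<Rightarrow> 'a mat" where
  "Ad n g X = g * X * inv\<^bsub>SL n\<^esub> g"

definition elem_mat :: "nat \<Rightarrow> nat \<Rightarrow> nat \<Rightarrow> 'a::zero \<Rightarrow> 'a mat" where
  "elem_mat n i j b = mat n n (\<lambda>p. if p = (i, j) then b else 0)"

(* Lie(N) is the space of strictly upper triangular matrices.  Its basis over the reals is the family
   of elem_mat n i j b with i < j < n and b in the basis of 'a over the reals ({1} or {1, \<i>}); the
   coordinate of X at (i, j, b) is (X $$ (i, j)) inner b. *)
definition lieN_basis :: "nat \<Rightarrow> (nat \<times> nat \<times> 'a::euclidean_space) set" where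
  "lieN_basis n = {(i, j, b). i < j \<and> j < n \<and> b \<in> Basis}"

definition det_Ad_lieN :: "nat \<Rightarrow> 'a::{field, euclidean_space} mat \<Rightarrow> real" where
  "det_Ad_lieN n a = det_over (lieN_basis n)
     (\<lambda>(i, j, b) (k, l, c). inner (Ad n a (elem_mat n k l c) $$ (i, j)) b)"

(* rho n a and Lambda k a are the values a^rho and a^(Lambda_k) of the characters, so that
   rho(log a) is ln (rho n a). *)
definition rho :: "nat \<Rightarrow> 'a::{field, euclidean_space} mat \<Rightarrow> real" where
  "rho n a = det_Ad_lieN n a powr (1/2)"

(* The entries of a are positive reals, so norm only converts from 'a to real. *)
definition Lambda :: "nat \<Rightarrow> 'a::real_normed_field mat \<Rightarrow> real" where
  "Lambda k a = norm (\<Prod>i<k. a $$ (i, i))"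

definition commN :: "nat \<Rightarrow> 'a::field mat set" where
  "commN n = derived (SL n) (unip_upper n)"

definition free_entries :: "nat \<Rightarrow> (nat \<times> nat) set" where
  "free_entries n = {(i, j). i + 1 < j \<and> j < n}"

definition of_entries :: "nat \<Rightarrow> (nat \<times> nat \<Rightarrow> 'a) \<Rightarrow> 'a::field mat" where
  "of_entries n x = mat n n (\<lambda>(i, j). if i = j then 1 else if i + 1 < j then x (i, j) else 0)"

definition entries :: "nat \<Rightarrow> 'a mat \<Rightarrow> nat \<times> nat \<Rightarrow> 'a" where
  "entries n v = restrict (\<lambda>p. v $$ p) (free_entries n)"

(* Lebesgue measure in the free entries, transported to a measure whose space is commN n; its
   sigma-algebra is the Borel one in the free entries.  See commN_eq and of_entries_measurable. *)
definition haar_commN :: "nat \<Rightarrow> 'a::{field, euclidean_space} mat measure" where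
  "haar_commN n =
     (let L = Pi\<^sub>M (free_entries n) (\<lambda>_. lborel)
      in distr L (vimage_algebra (commN n) (entries n) L) (of_entries n))"

lemma carrier_SL: "g \<in> carrier (SL n) \<longleftrightarrow> g \<in> carrier_mat n n \<and> Determinant.det g = 1"
  and mult_SL: "x \<otimes>\<^bsub>SL n\<^esub> y = x * y"
  and one_SL: "\<one>\<^bsub>SL n\<^esub> = 1\<^sub>m n"
  by (simp_all add: SL_def)

lemma group_SL: "group (SL n :: 'a::field mat monoid)"
proof (rule groupI)
  fix x :: "'a mat" assume x: "x \<in> carrier (SL n)"
  then have xc: "x \<in> carrier_mat n n" and d: "Determinant.det x = 1" by (auto simp: carrier_SL)
  have c: "adj_mat x \<in> carrier_mat n n" and e: "adj_mat x * x = 1\<^sub>m n"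
    using adj_mat[OF xc] d by auto
  then have "Determinant.det (adj_mat x) = 1"
    using det_mult[OF c xc] d by simp
  then show "\<exists>y\<in>carrier (SL n). y \<otimes>\<^bsub>SL n\<^esub> x = \<one>\<^bsub>SL n\<^esub>"
    using c e by (auto simp: carrier_SL mult_SL one_SL)
next
  fix x y :: "'a mat" assume "x \<in> carrier (SL n)" "y \<in> carrier (SL n)"
  then show "x \<otimes>\<^bsub>SL n\<^esub> y \<in> carrier (SL n)"
    by (auto simp: carrier_SL mult_SL det_mult[of _ n])
qed (auto simp: carrier_SL mult_SL one_SL)

lemma inv_SL_eqI:
  assumes "x \<in> carrier (SL n)" "y \<in> carrier (SL n)" "x * y = 1\<^sub>m n"
  shows "inv\<^bsub>SL n\<^esub> x = (y :: 'a::field mat)"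
proof -
  interpret group "SL n :: 'a mat monoid" by (rule group_SL)
  have "y \<otimes>\<^bsub>SL n\<^esub> x = \<one>\<^bsub>SL n\<^esub>"
    using inv_comm[OF _ assms(1,2)] assms by (simp add: mult_SL one_SL)
  then show ?thesis by (rule inv_equality[OF _ assms(1,2)])
qed

lemma mat_mult_index:
  assumes "v \<in> carrier_mat n n" "w \<in> carrier_mat n n" "i < n" "j < n"
  shows "(v * w) $$ (i, j) = (\<Sum>k<n. v $$ (i, k) * (w $$ (k, j) :: 'a::field))"
  using assms by (auto simp: scalar_prod_def lessThan_atLeast0 intro!: sum.cong)

lemma unip_upper_iff:
  "v \<in> unip_upper n \<longleftrightarrow> v \<in> carrier_mat n n \<and> (\<forall>i<n. \<forall>j<i. v $$ (i, j) = 0) \<and>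
     (\<forall>i<n. v $$ (i, i) = (1 :: 'a::field))"
proof -
  have "Determinant.det v = 1" if "v \<in> carrier_mat n n" "upper_triangular v" "\<forall>i<n. v $$ (i, i) = 1"
    using det_upper_triangular[OF that(2,1)] that
    by (auto simp: prod_list_diag_prod intro!: prod.neutral)
  then show ?thesis by (auto simp: unip_upper_def carrier_SL upper_triangular_def)
qed

lemma unip_mult:
  assumes "v \<in> unip_upper n" "w \<in> unip_upper n"
  shows "v * w \<in> unip_upper n"
    and "i + 1 < n \<Longrightarrow> (v * w) $$ (i, i + 1) = v $$ (i, i + 1) + (w $$ (i, i + 1) :: 'a::field)"
proof -
  have c: "v \<in> carrier_mat n n" "w \<in> carrier_mat n n" using assms by (auto simp: unip_upper_iff)
  have z: "v $$ (i, j) = 0" "w $$ (i, j) = 0" if "j < i" "i < n" for i j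
    using assms that by (auto simp: unip_upper_iff)
  have o: "v $$ (i, i) = 1" "w $$ (i, i) = 1" if "i < n" for i
    using assms that by (auto simp: unip_upper_iff)
  have "(v * w) $$ (i, j) = 0" if "j < i" "i < n" for i j
    unfolding mat_mult_index[OF c that(2) less_trans[OF that]]
  proof (rule sum.neutral, rule ballI)
    fix k assume "k \<in> {..<n}"
    then show "v $$ (i, k) * w $$ (k, j) = 0"
      using z[of k i] z[of j k] that by (cases "k < i") auto
  qed
  moreover have "(v * w) $$ (i, i) = 1" if "i < n" for i
  proof -
    have "(v * w) $$ (i, i) = (\<Sum>k<n. if k = i then 1 else 0)"
      unfolding mat_mult_index[OF c that that]
    proof (rule sum.cong)
      fix k assume "k \<in> {..<n}"
      then show "v $$ (i, k) * w $$ (k, i) = (if k = i then 1 else 0)"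
        using z[of k i] z[of i k] that o[of i] by (cases i k rule: linorder_cases) auto
    qed simp
    then show ?thesis using that by simp
  qed
  ultimately show "v * w \<in> unip_upper n" using c by (auto simp: unip_upper_iff)
  assume i: "i + 1 < n"
  have "(v * w) $$ (i, i + 1) =
      (\<Sum>k<n. (if k = i then w $$ (i, i + 1) else 0) + (if k = i + 1 then v $$ (i, i + 1) else 0))"
    unfolding mat_mult_index[OF c Suc_lessD[OF i[unfolded Suc_eq_plus1[symmetric]]] i]
  proof (intro sum.cong refl)
    fix k assume "k \<in> {..<n}"
    then consider "k < i" | "k = i" | "k = Suc i" | "k > Suc i" "k < n" by fastforce
    then show "v $$ (i, k) * w $$ (k, i + 1) =
      (if k = i then w $$ (i, i + 1) else 0) + (if k = i + 1 then v $$ (i, i + 1) else 0)"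
      using i z[of k i] z[of "Suc i" k] o[of i] o[of "Suc i"] by cases auto
  qed
  also have "\<dots> = v $$ (i, i + 1) + w $$ (i, i + 1)"
    using i by (simp add: sum.distrib)
  finally show "(v * w) $$ (i, i + 1) = v $$ (i, i + 1) + w $$ (i, i + 1)" .
qed

lemma unip_upper_subset: "unip_upper n \<subseteq> carrier (SL n)"
  by (auto simp: unip_upper_def)

lemma one_unip: "1\<^sub>m n \<in> unip_upper n"
  by (auto simp: unip_upper_iff)

lemma unip_inv:
  assumes v: "v \<in> unip_upper n"
  shows "inv\<^bsub>SL n\<^esub> v \<in> unip_upper n"
    and "i + 1 < n \<Longrightarrow> (inv\<^bsub>SL n\<^esub> v) $$ (i, i + 1) = - (v $$ (i, i + 1) :: 'a::field)"
proof -
  interpret group "SL n :: 'a mat monoid" by (rule group_SL)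
  define w where "w = inv\<^bsub>SL n\<^esub> v"
  have vS: "v \<in> carrier (SL n)" using v unip_upper_subset by blast
  then have wS: "w \<in> carrier (SL n)" by (simp add: w_def)
  have e: "v * w = 1\<^sub>m n"
    using r_inv[OF vS] by (simp add: mult_SL one_SL w_def)
  have c: "v \<in> carrier_mat n n" "w \<in> carrier_mat n n" using vS wS by (auto simp: carrier_SL)
  have z: "v $$ (i, j) = 0" if "j < i" "i < n" for i j using v that by (auto simp: unip_upper_iff)
  have o: "v $$ (i, i) = 1" if "i < n" for i using v that by (auto simp: unip_upper_iff)
  have *: "\<forall>j\<le>i. w $$ (i, j) = (if i = j then 1 else 0)" if "i < n" for i
    using that
  proof (induction "n - i" arbitrary: i rule: less_induct)
    case less
    show ?case
    proof (intro allI impI)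
      fix j assume j: "j \<le> i"
      have "(v * w) $$ (i, j) = (\<Sum>k<n. if k = i then w $$ (i, j) else 0)"
        unfolding mat_mult_index[OF c less(2) le_less_trans[OF j less(2)]]
      proof (rule sum.cong)
        fix k assume k: "k \<in> {..<n}"
        have "w $$ (k, j) = 0" if "k > i" using less(1)[of k] that k less(2) j by auto
        then show "v $$ (i, k) * w $$ (k, j) = (if k = i then w $$ (i, j) else 0)"
          using z[of k i] less(2) o[of i] by (cases k i rule: linorder_cases) auto
      qed simp
      then have "(v * w) $$ (i, j) = w $$ (i, j)" using less(2) by simp
      then show "w $$ (i, j) = (if i = j then 1 else 0)" using e less(2) j by auto
    qed
  qed
  have wN: "w \<in> unip_upper n"
    unfolding unip_upper_iff using c(2) * by auto
  then show "inv\<^bsub>SL n\<^esub> v \<in> unip_upper n" by (simp add: w_def)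
  assume i: "i + 1 < n"
  show "(inv\<^bsub>SL n\<^esub> v) $$ (i, i + 1) = - v $$ (i, i + 1)"
    using unip_mult(2)[OF v wN i] e i by (simp add: w_def eq_neg_iff_add_eq_0 add.commute)
qed

definition unip_upper2 :: "nat \<Rightarrow> 'a::field mat set" where
  "unip_upper2 n = {v \<in> unip_upper n. \<forall>i. i + 1 < n \<longrightarrow> v $$ (i, i + 1) = 0}"

lemma subgroup_unip_upper2: "subgroup (unip_upper2 n) (SL n :: 'a::field mat monoid)"
proof
  show "unip_upper2 n \<subseteq> carrier (SL n)" using unip_upper_subset by (auto simp: unip_upper2_def)
  show "\<one>\<^bsub>SL n\<^esub> \<in> unip_upper2 n" by (auto simp: unip_upper2_def one_SL one_unip)
next
  fix x y :: "'a mat" assume "x \<in> unip_upper2 n" "y \<in> unip_upper2 n"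
  then show "x \<otimes>\<^bsub>SL n\<^esub> y \<in> unip_upper2 n"
    using unip_mult[of x n y] by (auto simp: unip_upper2_def mult_SL)
next
  fix x :: "'a mat" assume "x \<in> unip_upper2 n"
  then show "inv\<^bsub>SL n\<^esub> x \<in> unip_upper2 n" using unip_inv[of x n] by (auto simp: unip_upper2_def)
qed

lemma commN_sub: "commN n \<subseteq> (unip_upper2 n :: 'a::field mat set)"
proof -
  interpret group "SL n :: 'a mat monoid" by (rule group_SL)
  have "x \<in> unip_upper2 n" if "x \<in> derived_set (SL n) (unip_upper n)" for x :: "'a mat"
  proof -
    obtain v w where vw: "v \<in> unip_upper n" "w \<in> unip_upper n"
      and x: "x = v * w * inv\<^bsub>SL n\<^esub> v * inv\<^bsub>SL n\<^esub> w" using \<open>x \<in> _\<close> by (auto simp: mult_SL)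
    note vi = unip_inv[OF vw(1)] and wi = unip_inv[OF vw(2)]
    note m1 = unip_mult[OF vw] 
    note m2 = unip_mult[OF m1(1) vi(1)]
    note m3 = unip_mult[OF m2(1) wi(1)]
    show ?thesis using m1 m2 m3 vi wi by (simp add: unip_upper2_def x)
  qed
  then show ?thesis
    unfolding commN_def derived_def by (intro generate_subgroup_incl subgroup_unip_upper2) blast
qed

lemma addrow_unip:
  assumes "k < l" shows "addrow_mat n (a::'a::field) k l \<in> unip_upper n"
  using assms by (auto simp: unip_upper_iff)

lemma addrow_comm:
  assumes "i < m" "m < j" "j < n"
  shows "addrow_mat n (x::'a::field) i j \<in> commN n"
proof -
  interpret group "SL n :: 'a mat monoid" by (rule group_SL)
  let ?P = "addrow_mat n x i m" and ?Q = "addrow_mat n 1 m j" and ?R = "addrow_mat n x i j"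
  have c: "?P \<in> carrier_mat n n" "?Q \<in> carrier_mat n n" "?R \<in> carrier_mat n n" by auto
  have N: "?P \<in> unip_upper n" "?Q \<in> unip_upper n" "?R \<in> unip_upper n"
    using assms by (auto intro!: addrow_unip)
  then have S: "?P \<in> carrier (SL n)" "?Q \<in> carrier (SL n)" "?R \<in> carrier (SL n)"
    using unip_upper_subset by blast+
  have "?P * ?Q = ?R * (?Q * ?P)"
    using assms
    by (subst addrow_mat[OF c(2), symmetric], simp, subst addrow_mat[OF c(1), symmetric], simp,
        subst addrow_mat[symmetric], auto intro!: eq_matI)
  then have "?P \<otimes>\<^bsub>SL n\<^esub> ?Q \<otimes>\<^bsub>SL n\<^esub> inv\<^bsub>SL n\<^esub> ?P \<otimes>\<^bsub>SL n\<^esub> inv\<^bsub>SL n\<^esub> ?Q = ?R"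
    using S by (metis (no_types, lifting) inv_closed inv_solve_right m_assoc m_closed mult_SL)
  then have "?R \<in> derived_set (SL n) (unip_upper n)"
    using N(1,2) by (metis (no_types, lifting) UN_iff singletonI)
  then show ?thesis unfolding commN_def derived_def by (rule generate.incl)
qed

lemma unip_upper2_sub: "(unip_upper2 n :: 'a::field mat set) \<subseteq> commN n"
proof
  interpret group "SL n :: 'a mat monoid" by (rule group_SL)
  have sg: "subgroup (commN n) (SL n :: 'a mat monoid)"
    unfolding commN_def by (rule derived_is_subgroup[OF unip_upper_subset])
  fix v :: "'a mat" assume "v \<in> unip_upper2 n"
  then show "v \<in> commN n"
  proof (induction "card {p \<in> free_entries n. v $$ p \<noteq> 0}" arbitrary: v rule: less_induct)
    case less
    have fin: "finite (free_entries n)"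
      by (rule finite_subset[of _ "{..<n} \<times> {..<n}"]) (auto simp: free_entries_def)
    let ?Z = "{p \<in> free_entries n. v $$ p \<noteq> 0}"
    have finZ: "finite ?Z" using fin by simp
    have cv: "v \<in> carrier_mat n n" and z: "\<And>i j. j < i \<Longrightarrow> i < n \<Longrightarrow> v $$ (i, j) = 0"
      and o: "\<And>i. i < n \<Longrightarrow> v $$ (i, i) = 1" and s: "\<And>i. i + 1 < n \<Longrightarrow> v $$ (i, i + 1) = 0"
      using less(2) by (auto simp: unip_upper2_def unip_upper_iff)
    show ?case
    proof (cases "?Z = {}")
      case True
      have "v = 1\<^sub>m n"
      proof (rule eq_matI)
        fix i j assume "i < dim_row (1\<^sub>m n)" "j < dim_col (1\<^sub>m n)"
        then have ij: "i < n" "j < n" by auto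
        consider "j < i" | "i = j" | "j = i + 1" | "i + 1 < j" by linarith
        then show "v $$ (i, j) = 1\<^sub>m n $$ (i, j)"
          using True ij z o s by cases (auto simp: free_entries_def)
      qed (use cv in auto)
      then show ?thesis using subgroup.one_closed[OF sg] by (simp add: one_SL)
    next
      case False
      define t where "t = Max (fst ` ?Z)"
      have "t \<in> fst ` ?Z" unfolding t_def using finZ False by (intro Max_in) auto
      then obtain j where tj: "(t, j) \<in> ?Z" by auto
      then have tjn: "t + 1 < j" "j < n" by (auto simp: free_entries_def)
      have row0: "v $$ (i, k) = 0" if "t < i" "i + 1 < k" "k < n" for i k
      proof (rule ccontr)
        assume "v $$ (i, k) \<noteq> 0"
        then have "(i, k) \<in> ?Z" using that by (auto simp: free_entries_def)
        then have "i \<in> fst ` ?Z" by force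
        then have "i \<le> t" unfolding t_def using finZ by (intro Max_ge) auto
        then show False using that by simp
      qed
      have rowj: "v $$ (j, k) = (if k = j then 1 else 0)" if "k < n" for k
      proof -
        consider "k < j" | "k = j" | "k = j + 1" | "j + 1 < k" by linarith
        then show ?thesis using tjn that z o s row0 by cases auto
      qed
      define x where "x = v $$ (t, j)"
      define w where "w = addrow (- x) t j v"
      have cw: "w \<in> carrier_mat n n" using cv by (simp add: w_def)
      have we: "w $$ (i, k) = (if i = t \<and> k = j then 0 else v $$ (i, k))" if "i < n" "k < n" for i k
        using that cv rowj by (auto simp: w_def x_def)
      have wS: "w \<in> unip_upper2 n"
        using cw tjn z o s by (auto simp: unip_upper2_def unip_upper_iff we)
      have "{p \<in> free_entries n. w $$ p \<noteq> 0} = ?Z - {(t, j)}"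
        by (auto simp: we free_entries_def split: if_splits)
      then have "card {p \<in> free_entries n. w $$ p \<noteq> 0} < card ?Z"
        using card_Diff1_less[OF finZ tj] by simp
      then have "w \<in> commN n" by (rule less(1)[OF _ wS])
      moreover have "addrow_mat n x t j \<in> commN n"
        by (rule addrow_comm[of t "t + 1" j]) (use tjn in auto)
      moreover have "v = addrow_mat n x t j * w"
        unfolding addrow_mat[OF cw tjn(2), symmetric]
        using cv cw tjn by (auto intro!: eq_matI simp: we rowj x_def)
      ultimately show ?thesis using subgroup.m_closed[OF sg] by (metis mult_SL)
    qed
  qed
qed

lemma commN_eq:
  "commN n = {v \<in> unip_upper n. \<forall>i. i + 1 < n \<longrightarrow> v $$ (i, i + 1) = (0::'a::field)}"
  unfolding unip_upper2_def[symmetric] by (rule equalityI[OF commN_sub unip_upper2_sub])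

lemma of_entries_in: "of_entries n x \<in> commN n"
  by (auto simp: commN_eq unip_upper_iff of_entries_def)

lemma entries_of_entries:
  "x \<in> extensional (free_entries n) \<Longrightarrow> entries n (of_entries n x) = x"
  by (auto simp: entries_def of_entries_def free_entries_def fun_eq_iff extensional_def)

lemma of_entries_entries: "v \<in> commN n \<Longrightarrow> of_entries n (entries n v) = v"
proof (rule eq_matI)
  fix i j assume v: "v \<in> commN n" and "i < dim_row v" "j < dim_col v"
  then have ij: "i < n" "j < n" and v2: "v \<in> unip_upper2 n" by (auto simp: commN_eq unip_upper_iff unip_upper2_def)
  consider "j < i" | "i = j" | "j = i + 1" | "i + 1 < j" by linarith
  then show "of_entries n (entries n v) $$ (i, j) = v $$ (i, j)"
    using ij v2 by cases (auto simp: unip_upper2_def unip_upper_iff of_entries_def entries_def free_entries_def)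
qed (auto simp: commN_eq unip_upper_iff of_entries_def)

lemma of_entries_measurable:
  "of_entries n \<in> measurable (Pi\<^sub>M (free_entries n) (\<lambda>_. lborel))
     (vimage_algebra (commN n) (entries n) (Pi\<^sub>M (free_entries n) (\<lambda>_. lborel :: 'a::{field,euclidean_space} measure)))"
proof (rule measurable_vimage_algebra2)
  show "of_entries n \<in> space (Pi\<^sub>M (free_entries n) (\<lambda>_. lborel)) \<rightarrow> (commN n :: 'a mat set)"
    by (auto simp: of_entries_in)
  show "(\<lambda>x. entries n (of_entries n x)) \<in> (Pi\<^sub>M (free_entries n) (\<lambda>_. lborel)) \<rightarrow>\<^sub>M (Pi\<^sub>M (free_entries n) (\<lambda>_. lborel :: 'a measure))"
    by (rule measurable_cong[THEN iffD1, OF _ measurable_ident])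
       (auto simp: entries_of_entries space_PiM PiE_def)
qed

lemma det_over_diag:
  assumes "finite I" "\<And>i j. i \<in> I \<Longrightarrow> j \<in> I \<Longrightarrow> i \<noteq> j \<Longrightarrow> M i j = 0"
  shows "det_over I M = (\<Prod>i\<in>I. M i i)"
proof -
  have "(\<Prod>i\<in>I. M i (p i)) = 0" if p: "p permutes I" "p \<noteq> id" for p
  proof -
    obtain i where "p i \<noteq> i" using p by (auto simp: fun_eq_iff)
    moreover from this have "i \<in> I" using p by (auto simp: permutes_def)
    ultimately show ?thesis using assms p(1) by (intro prod_zero) (auto simp: permutes_in_image intro!: bexI[of _ i])
  qed
  then have "det_over I M = (\<Sum>p\<in>{id}. of_int (sign p) * (\<Prod>i\<in>I. M i (p i)))"
    unfolding det_over_def using assms(1)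
    by (intro sum.mono_neutral_right) (auto simp: finite_permutations permutes_id)
  then show ?thesis by (simp add: sign_id)
qed

lemma det_Ad_lieN_eq:
  fixes a :: "'a::{real_normed_field, euclidean_space} mat"
  assumes a: "a \<in> pos_diag n"
  shows "det_Ad_lieN n a =
    (\<Prod>(i, j)\<in>{(i, j). i < j \<and> j < n}. (norm (a $$ (i, i)) / norm (a $$ (j, j))) ^ DIM('a))"
proof -
  interpret group "SL n :: 'a mat monoid" by (rule group_SL)
  obtain x where x: "\<And>i. i < n \<Longrightarrow> x i > 0 \<and> a $$ (i, i) = of_real (x i)"
    using a unfolding pos_diag_def mem_Collect_eq by metis
  have nz: "x i \<noteq> 0" if "i < n" for i using x[OF that] by simp
  have ac: "a \<in> carrier_mat n n" and d: "Determinant.det a = 1" and dg: "\<And>i j. i < n \<Longrightarrow> j < n \<Longrightarrow> i \<noteq> j \<Longrightarrow> a $$ (i, j) = 0"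
    using a by (auto simp: pos_diag_def carrier_SL diagonal_mat_def)
  define b where "b = mat_diag n (\<lambda>i. of_real (1 / x i) :: 'a)"
  have bc: "b \<in> carrier_mat n n" by (simp add: b_def)
  have aeq: "a = mat_diag n (\<lambda>i. of_real (x i))"
    by (rule eq_matI) (use ac dg x in \<open>auto simp: mat_diag_def\<close>)
  have ab: "a * b = 1\<^sub>m n"
    unfolding aeq b_def mat_diag_diag by (rule eq_matI) (use nz in \<open>auto simp: mat_diag_def simp flip: of_real_mult\<close>)
  have "Determinant.det b = 1" using det_mult[OF ac bc] d ab by simp
  then have inv: "inv\<^bsub>SL n\<^esub> a = b"
    by (intro inv_SL_eqI ab) (auto simp: carrier_SL ac bc d)
  have Ad: "Ad n a (elem_mat n k l c) $$ (i, j) = (if (i, j) = (k, l) then (x k / x l) *\<^sub>R c else 0)"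
    if "i < n" "j < n" for i j k l c
  proof -
    have e: "elem_mat n k l c \<in> carrier_mat n n" by (simp add: elem_mat_def)
    have "Ad n a (elem_mat n k l c) $$ (i, j) = of_real (x i) * elem_mat n k l c $$ (i, j) * of_real (1 / x j)"
      unfolding Ad_def inv unfolding aeq b_def mat_diag_mult_left[OF e]
      by (subst mat_diag_mult_right) (use that e in auto)
    then show ?thesis using that by (auto simp: elem_mat_def scaleR_conv_of_real)
  qed
  let ?P = "{(i, j). i < j \<and> j < n}"
  have finP: "finite ?P" by (rule finite_subset[of _ "{..<n} \<times> {..<n}"]) auto
  have L: "lieN_basis n = (\<lambda>((i, j), b). (i, j, b)) ` (?P \<times> (Basis :: 'a set))"
    by (auto simp: lieN_basis_def image_iff)
  have fin: "finite (lieN_basis n :: (nat \<times> nat \<times> 'a) set)" using finP by (auto simp: L)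
  let ?M = "\<lambda>(i, j, b) (k, l, c). inner (Ad n a (elem_mat n k l c) $$ (i, j)) (b :: 'a)"
  have "det_Ad_lieN n a = (\<Prod>p\<in>lieN_basis n. ?M p p)"
    unfolding det_Ad_lieN_def
    by (rule det_over_diag[OF fin]) (auto simp: lieN_basis_def Ad inner_Basis split: if_splits)
  also have "\<dots> = (\<Prod>(i, j, b::'a)\<in>lieN_basis n. x i / x j)"
    by (rule prod.cong) (auto simp: lieN_basis_def Ad)
  also have "\<dots> = (\<Prod>p\<in>?P \<times> (Basis :: 'a set). x (fst (fst p)) / x (snd (fst p)))"
    unfolding L by (subst prod.reindex) (auto simp: inj_on_def case_prod_beta)
  also have "\<dots> = (\<Prod>p\<in>?P. \<Prod>b\<in>(Basis :: 'a set). x (fst p) / x (snd p))"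
    by (subst prod.cartesian_product[symmetric, where g = "\<lambda>p b. x (fst p) / x (snd p)", unfolded case_prod_beta]) simp
  also have "\<dots> = (\<Prod>(i, j)\<in>?P. (norm (a $$ (i, i)) / norm (a $$ (j, j))) ^ DIM('a))"
    using x by (intro prod.cong) (auto simp: less_imp_le abs_of_pos)
  finally show ?thesis .
qed

end

(* Write a matrix v in [N,N] of size m + 1 as ((w, y), (0, 1)), let w = L k with L lower triangular and
   k unitary, and put y = L u.  Then a^Lambda_i multiplies by sqrt (1 + |u_0|^2 + ... + |u_(i-1)|^2) in
   passing from w to v (i <= m), and dy is D^(dim F) du with D = a(w)^Lambda_(m-1).  The last entry of y
   vanishes, so u_(m-1) is a linear form b u in the other coordinates, and 1 + |b|^2 = D^2.  The
   integral over u of the resulting product is therefore O(D^(-gamma)) for some gamma > 0, by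
   integrating first over the coordinate with the largest |b_j|.  This drives an induction
   on n for the integral of prod_(i<n-1) a^(-(1-eps) (dim F) Lambda_i) times a^(-delta Lambda_(n-1)), where
   delta > 0 is arbitrary and eps > 0 depends on delta; the small eps absorbs the logarithm,
   because rho is the (dim F)-fold sum of all Lambda_i. *)

theory Submission
  imports Defs
begin

text \<open>Up to eps every exponent is critical. The weight of v contains a(w)^(-(dim F)
  Lambda_(m-1)), which the Jacobian D^(dim F) cancels, and each factor (1 + |u_0|^2 + ... +
  |u_j|^2)^(-(dim F)/2) just fails to be integrable. Convergence over u must therefore be paid for
  by the factor with exponent \<delta>, and after the last column is integrated out nothing would
  control the last character of w. Only the vanishing superdiagonal entry helps: it makes u_(m-1) =
  b u large for most u when b is large, and |b| measures D. The gain is a small power of D, which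
  serves as the \<delta> of the smaller matrix. Hence the induction must allow every \<delta> > 0,
  and eps is chosen after the gain is known. L is chosen separately for each w and its dependence on
  w is never shown to be measurable. This is harmless because the integrand is written with leading
  Gram minors, which are explicit in the entries, and because the bound for the inner integral is
  uniform in b.\<close>

section \<open>Scalars: one class for the real and the complex field\<close>

class conj_normed_field = conjugatable_field + real_normed_field + euclidean_space +
  assumes mult_conjugate_scaleR: "x * conjugate x = (norm x)\<^sup>2 *\<^sub>R 1"

instance real :: conj_normed_field
  by standard (simp add: power2_eq_square)

instance complex :: conj_normed_field
  by standard (simp add: complex_norm_square[symmetric] scaleR_conv_of_real)

lemma mult_conjugate: "x * conjugate x = (of_real ((norm x)\<^sup>2) :: 'a::conj_normed_field)"
  using mult_conjugate_scaleR[of x] by (simp add: scaleR_conv_of_real)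

lemma conjugate_of_real [simp]: "conjugate (of_real t) = (of_real t :: 'a::conj_normed_field)"
proof (cases "t = 0")
  case False
  have "of_real t * conjugate (of_real t :: 'a) = of_real t * of_real t"
    by (simp add: mult_conjugate power2_eq_square)
  then show ?thesis using False by simp
qed simp

lemma conjugate_mult_self: "conjugate x * x = (of_real ((norm x)\<^sup>2) :: 'a::conj_normed_field)"
  using mult_conjugate[of x] by (simp add: mult.commute)

lemma conjugate_sum: "conjugate (sum f A) = (\<Sum>x\<in>A. conjugate (f x :: 'a::conjugatable_ring))"
  by (induction A rule: infinite_finite_induct) (auto simp: conjugate_dist_add)

section \<open>Partial sums of squares and the Cholesky factor of a rank-one update\<close>

definition psum :: "(nat \<Rightarrow> 'a::real_normed_vector) \<Rightarrow> nat \<Rightarrow> real" where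
  "psum u i = 1 + (\<Sum>j<i. (norm (u j))\<^sup>2)"

lemma psum_ge_1: "1 \<le> psum u i"
  by (simp add: psum_def sum_nonneg)

lemma psum_pos [simp]: "0 < psum u i"
  using psum_ge_1[of u i] by linarith

lemma psum_nz [simp]: "psum u i \<noteq> 0"
  using psum_pos[of u i] by linarith

lemma psum_0 [simp]: "psum u 0 = 1"
  by (simp add: psum_def)

lemma psum_Suc: "psum u (Suc i) = psum u i + (norm (u i))\<^sup>2"
  by (simp add: psum_def)

lemma psum_cong: "(\<And>j. j < i \<Longrightarrow> u j = w j) \<Longrightarrow> psum u i = psum w i"
  by (simp add: psum_def)

text \<open>Each summand is a difference of reciprocals of consecutive partial sums. Such sums are
  what the strictly lower part of \<open>cholU\<close> contributes to its Gram matrix.\<close>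

lemma psum_telescope:
  "(\<Sum>l<i. (norm (u l))\<^sup>2 / (psum u l * psum u (Suc l))) = 1 - 1 / psum u i"
proof (induction i)
  case (Suc i)
  have "(b - a) / (a * b) = 1 / a - 1 / b" if "a \<noteq> 0" "b \<noteq> 0" for a b :: real
    using that by (simp add: field_simps)
  from this[OF psum_nz[of u i] psum_nz[of u "Suc i"]]
  have "(norm (u i))\<^sup>2 / (psum u i * psum u (Suc i)) = 1 / psum u i - 1 / psum u (Suc i)"
    by (simp add: psum_Suc[of u i])
  then show ?case
    by (simp only: sum.lessThan_Suc Suc)
qed simp

text \<open>The lower triangular Cholesky factor of \<open>diag (1, \<dots>, 1, 0) + u u\<^sup>*\<close> of size \<open>m + 1\<close>, where
  \<open>u\<^sub>m = 1\<close>; this is the Gram matrix of the rows of the unipotent matrix whose only nontrivial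
  column is its last one, \<open>u\<close>.\<close>

definition cholU :: "nat \<Rightarrow> (nat \<Rightarrow> 'a::conj_normed_field) \<Rightarrow> nat \<Rightarrow> nat \<Rightarrow> 'a" where
  "cholU m u i j =
    (if j < i then u i * conjugate (u j) / of_real (sqrt (psum u j * psum u (Suc j)))
     else if j = i then of_real (if i < m then sqrt (psum u (Suc i) / psum u i) else 1 / sqrt (psum u i))
     else 0)"

lemma conjugate_divide_of_real:
  "conjugate (x / of_real t) = conjugate x / (of_real t :: 'a::conj_normed_field)"
proof -
  have "conjugate (x * of_real (1/t)) = conjugate x * (of_real (1/t) :: 'a)"
    by (simp only: conjugate_dist_mul conjugate_of_real)
  then show ?thesis by (simp add: divide_inverse)
qed

text \<open>Triangularity cuts the sum off after l = i. The terms with l < i telescope to u i *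
  conjugate (u j) * (1 - 1 / psum u i), and the term l = i restores the missing 1 / psum u i, on the
  diagonal together with the extra 1 coming from psum u (Suc i) = psum u i + |u i|^2.\<close>

lemma cholU_gram_le:
  fixes u :: "nat \<Rightarrow> 'a::conj_normed_field"
  assumes "i \<le> j" "j \<le> m" "u m = 1"
  shows "(\<Sum>l<Suc m. cholU m u i l * conjugate (cholU m u j l)) =
    (if i = j \<and> i < m then 1 else 0) + u i * conjugate (u j)"
proof -
  have "(\<Sum>l<Suc m. cholU m u i l * conjugate (cholU m u j l)) =
      (\<Sum>l<Suc i. cholU m u i l * conjugate (cholU m u j l))"
    using assms by (intro sum.mono_neutral_right) (auto simp: cholU_def)
  also have "\<dots> = (\<Sum>l<i. cholU m u i l * conjugate (cholU m u j l)) + cholU m u i i * conjugate (cholU m u j i)"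
    by simp
  also have "(\<Sum>l<i. cholU m u i l * conjugate (cholU m u j l)) =
      (\<Sum>l<i. u i * conjugate (u j) * of_real ((norm (u l))\<^sup>2 / (psum u l * psum u (Suc l))))"
  proof (rule sum.cong)
    fix l assume "l \<in> {..<i}"
    then have l: "l < i" "l < j" using assms by auto
    define s where "s = sqrt (psum u l * psum u (Suc l))"
    have s: "s \<noteq> 0" "s * s = psum u l * psum u (Suc l)"
      by (auto simp: s_def less_imp_le)
    have "cholU m u i l * conjugate (cholU m u j l) =
      (u i * conjugate (u l) / of_real s) * (conjugate (u j) * u l / of_real s)"
      using l by (simp add: cholU_def s_def[symmetric] conjugate_divide_of_real conjugate_dist_mul)
    also have "\<dots> = u i * conjugate (u j) * (conjugate (u l) * u l / of_real (s * s))"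
      by simp
    also have "\<dots> = u i * conjugate (u j) * of_real ((norm (u l))\<^sup>2 / (psum u l * psum u (Suc l)))"
      by (simp only: conjugate_mult_self s of_real_divide)
    finally show "cholU m u i l * conjugate (cholU m u j l) =
      u i * conjugate (u j) * of_real ((norm (u l))\<^sup>2 / (psum u l * psum u (Suc l)))" .
  qed simp
  also have "\<dots> = u i * conjugate (u j) * of_real (1 - 1 / psum u i)"
    by (simp only: sum_distrib_left[symmetric] of_real_sum[symmetric] psum_telescope)
  finally have *: "(\<Sum>l<Suc m. cholU m u i l * conjugate (cholU m u j l)) =
      u i * conjugate (u j) * of_real (1 - 1 / psum u i) + cholU m u i i * conjugate (cholU m u j i)" .
  show ?thesis
  proof (cases "i = j")
    case True
    have "cholU m u i i * conjugate (cholU m u i i) =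
      of_real ((if i < m then sqrt (psum u (Suc i) / psum u i) else 1 / sqrt (psum u i))\<^sup>2)"
      by (simp add: cholU_def power2_eq_square)
    also have "\<dots> = of_real ((if i < m then 1 else 0) + (norm (u i))\<^sup>2 / psum u i)"
    proof (cases "i < m")
      case True
      then show ?thesis by (simp add: psum_Suc add_divide_distrib less_imp_le)
    next
      case False
      \<comment> \<open>At the bottom index the squared diagonal entry 1 / psum u m equals |u m|^2 /
        psum u m; no extra 1 appears, which accounts for the 0 in diag (1, ..., 1, 0).\<close>
      then have "u i = 1" using assms True by simp
      then show ?thesis using False by (simp add: power_divide less_imp_le)
    qed
    also have "\<dots> = (if i < m then 1 else 0) + u i * conjugate (u i) * of_real (1 / psum u i)"
      by (simp add: mult_conjugate)
    finally show ?thesis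
      using * True by (simp add: algebra_simps)
  next
    case False
    define p q where "p = sqrt (psum u i)" and "q = sqrt (psum u (Suc i))"
    have pq: "p > 0" "q > 0" "p * p = psum u i" by (auto simp: p_def q_def less_imp_le)
    have "cholU m u i i = of_real (q / p)" "cholU m u j i = u j * conjugate (u i) / of_real (p * q)"
      using False assms by (simp_all add: cholU_def p_def q_def real_sqrt_mult real_sqrt_divide)
    then have "cholU m u i i * conjugate (cholU m u j i) =
      of_real (q / p) * (u i * conjugate (u j) / of_real (p * q))"
      by (simp only: conjugate_divide_of_real conjugate_dist_mul conjugate_id mult.commute)
    also have "\<dots> = u i * conjugate (u j) * of_real ((q / p) / (p * q))"
      by simp
    also have "(q / p) / (p * q) = 1 / psum u i"
      using pq(1,2) by (simp add: pq(3)[symmetric] field_simps)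
    finally show ?thesis
      using * False by (simp add: algebra_simps)
  qed
qed

lemma cholU_gram:
  fixes u :: "nat \<Rightarrow> 'a::conj_normed_field"
  assumes "i \<le> m" "j \<le> m" "u m = 1"
  shows "(\<Sum>l<Suc m. cholU m u i l * conjugate (cholU m u j l)) =
    (if i = j \<and> i < m then 1 else 0) + u i * conjugate (u j)"
proof (cases "i \<le> j")
  case True
  then show ?thesis using cholU_gram_le assms by blast
next
  case False
  then have "conjugate (\<Sum>l<Suc m. cholU m u j l * conjugate (cholU m u i l)) =
    conjugate ((if j = i \<and> j < m then 1 else 0) + u j * conjugate (u i))"
    using cholU_gram_le[of j i m u] assms by simp
  then show ?thesis
    using False by (simp add: conjugate_sum conjugate_dist_mul conjugate_dist_add mult.commute)
qed

section \<open>Cholesky factors, built up by adding a last row and column\<close>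

text \<open>Index functions instead of matrices let the size grow without conversions. The diagonal
  is kept separately as the real sequence \<open>\<eta>\<close>, since its prefix products are the
  characters of the Iwasawa component.\<close>

definition cholesky :: "nat \<Rightarrow> (nat \<Rightarrow> nat \<Rightarrow> 'a::conj_normed_field) \<Rightarrow> (nat \<Rightarrow> nat \<Rightarrow> 'a) \<Rightarrow> (nat \<Rightarrow> real) \<Rightarrow> bool"
  where
  "cholesky n v L \<eta> \<longleftrightarrow>
    (\<forall>i<n. 0 < \<eta> i \<and> L i i = of_real (\<eta> i)) \<and>
    (\<forall>i<n. \<forall>j<n. i < j \<longrightarrow> L i j = 0) \<and>
    (\<forall>i<n. \<forall>j<n. (\<Sum>l<n. v i l * conjugate (v j l)) = (\<Sum>l<n. L i l * conjugate (L j l)))"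

text \<open>With X = diag (L, 1) and w = (u, 1), the last column of v' is X w, so the Gram matrix of
  the rows of v' is X (diag (1, ..., 1, 0) + w w^H) X^H, where H denotes the adjoint.
  \<open>cholU\<close> factors the middle matrix, and the product of X with it is again lower
  triangular with positive diagonal.\<close>

lemma cholesky_Suc:
  fixes v v' :: "nat \<Rightarrow> nat \<Rightarrow> 'a::conj_normed_field"
  assumes L: "cholesky m v L \<eta>"
    and vv: "\<And>i j. i < m \<Longrightarrow> j < m \<Longrightarrow> v' i j = v i j"
    and col: "\<And>i. i < m \<Longrightarrow> v' i m = (\<Sum>j<m. L i j * u j)"
    and row: "\<And>j. j < m \<Longrightarrow> v' m j = 0" "v' m m = 1"
  obtains L' where "cholesky (Suc m) v' L'
    (\<lambda>i. if i < m then \<eta> i * sqrt (psum u (Suc i) / psum u i) else 1 / sqrt (psum u m))"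
proof -
  define w where "w = u(m := 1)"
  define X where "X i j = (if i < m \<and> j < m then L i j else if i = j then 1 else 0)" for i j
  define L' where "L' i j = (\<Sum>l<Suc m. X i l * cholU m w l j)" for i j
  have wm: "w m = 1" by (simp add: w_def)
  have psw: "psum w i = psum u i" if "i \<le> m" for i
    using that by (intro psum_cong) (simp add: w_def)
  have Xw: "(\<Sum>p<Suc m. X i p * w p) = v' i m" if "i \<le> m" for i
  proof (cases "i < m")
    case True
    then show ?thesis by (simp add: X_def w_def col)
  next
    case False
    then have "i = m" using that by simp
    moreover have "(\<Sum>p<m. X m p * w p) = 0" by (intro sum.neutral) (simp add: X_def)
    moreover have "X m m = 1" by (simp add: X_def)
    ultimately show ?thesis by (simp add: wm row)
  qed
  have XX: "(\<Sum>p<m. X i p * conjugate (X j p)) = (\<Sum>l<m. v' i l * conjugate (v' j l))"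
    if "i \<le> m" "j \<le> m" for i j
  proof (cases "i < m \<and> j < m")
    case True
    then show ?thesis using L by (simp add: X_def cholesky_def vv)
  next
    case False
    then show ?thesis using that by (auto simp: X_def row intro!: sum.cong)
  qed
  have G: "(\<Sum>l<Suc m. L' i l * conjugate (L' j l)) = (\<Sum>l<Suc m. v' i l * conjugate (v' j l))"
    if ij: "i \<le> m" "j \<le> m" for i j
  proof -
    have "(\<Sum>l<Suc m. L' i l * conjugate (L' j l)) =
      (\<Sum>l<Suc m. \<Sum>p<Suc m. \<Sum>q<Suc m. X i p * conjugate (X j q) * (cholU m w p l * conjugate (cholU m w q l)))"
      unfolding L'_def conjugate_sum conjugate_dist_mul sum_product
      by (intro sum.cong refl) (simp add: mult_ac)
    also have "\<dots> = (\<Sum>p<Suc m. \<Sum>q<Suc m. \<Sum>l<Suc m. X i p * conjugate (X j q) * (cholU m w p l * conjugate (cholU m w q l)))"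
      by (subst sum.swap) (intro sum.cong refl sum.swap)
    also have "\<dots> = (\<Sum>p<Suc m. \<Sum>q<Suc m. X i p * conjugate (X j q) * ((if p = q \<and> p < m then 1 else 0) + w p * conjugate (w q)))"
    proof (intro sum.cong refl)
      fix p q assume "p \<in> {..<Suc m}" "q \<in> {..<Suc m}"
      then show "(\<Sum>l<Suc m. X i p * conjugate (X j q) * (cholU m w p l * conjugate (cholU m w q l))) =
        X i p * conjugate (X j q) * ((if p = q \<and> p < m then 1 else 0) + w p * conjugate (w q))"
        using cholU_gram[of p m q w] by (simp only: sum_distrib_left[symmetric] lessThan_iff less_Suc_eq_le wm)
    qed
    also have "\<dots> = (\<Sum>p<Suc m. \<Sum>q<Suc m. if q = p then (if p < m then X i p * conjugate (X j p) else 0) else 0) +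
      (\<Sum>p<Suc m. \<Sum>q<Suc m. (X i p * w p) * conjugate (X j q * w q))"
      unfolding sum.distrib[symmetric] by (intro sum.cong refl) (auto simp: algebra_simps conjugate_dist_mul)
    also have "(\<Sum>p<Suc m. \<Sum>q<Suc m. (X i p * w p) * conjugate (X j q * w q)) = v' i m * conjugate (v' j m)"
      using ij by (simp only: sum_product[symmetric] conjugate_sum[symmetric] Xw)
    also have "(\<Sum>p<Suc m. \<Sum>q<Suc m. if q = p then (if p < m then X i p * conjugate (X j p) else 0) else 0) =
      (\<Sum>l<m. v' i l * conjugate (v' j l))"
      using XX[OF ij] by (simp add: sum.delta')
    finally show ?thesis by simp
  qed
  have cU0: "cholU m w l j = 0" if "l < j" for l j using that by (simp add: cholU_def)
  have X0: "X i l = 0" if "i < l" "i \<le> m" "l \<le> m" for i l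
    using L that by (auto simp: X_def cholesky_def)
  have diag: "L' i i = X i i * cholU m w i i" if "i \<le> m" for i
  proof -
    have "L' i i = (\<Sum>l<Suc m. if l = i then X i i * cholU m w i i else 0)"
      unfolding L'_def
    proof (intro sum.cong refl)
      fix l assume "l \<in> {..<Suc m}"
      then show "X i l * cholU m w l i = (if l = i then X i i * cholU m w i i else 0)"
        using X0[of i l] cU0[of l i] that by (cases l i rule: linorder_cases) auto
    qed
    then show ?thesis using that by simp
  qed
  have tri: "L' i j = 0" if "i < j" "j \<le> m" for i j
    unfolding L'_def
  proof (intro sum.neutral ballI)
    fix l assume "l \<in> {..<Suc m}"
    then show "X i l * cholU m w l j = 0"
      using X0[of i l] cU0[of l j] that by (cases "i < l") auto
  qed
  have "cholesky (Suc m) v' L'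
    (\<lambda>i. if i < m then \<eta> i * sqrt (psum u (Suc i) / psum u i) else 1 / sqrt (psum u m))"
    unfolding cholesky_def
  proof (intro conjI allI impI)
    fix i assume i: "i < Suc m"
    show "0 < (if i < m then \<eta> i * sqrt (psum u (Suc i) / psum u i) else 1 / sqrt (psum u m))"
      using L i by (auto simp: cholesky_def)
    show "L' i i = of_real (if i < m then \<eta> i * sqrt (psum u (Suc i) / psum u i) else 1 / sqrt (psum u m))"
    proof (cases "i < m")
      case True
      then show ?thesis using L diag[of i] psw[of i] psw[of "Suc i"] by (simp add: X_def cholU_def cholesky_def)
    next
      case False
      then have "i = m" using i by simp
      then show ?thesis using diag[of m] psw[of m] by (simp add: X_def cholU_def)
    qed
  qed (use G tri in auto)
  then show thesis by (rule that)
qed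

lemma triangular_solve:
  fixes L :: "nat \<Rightarrow> nat \<Rightarrow> 'a::field"
  assumes "\<And>i. i < k \<Longrightarrow> L i i \<noteq> 0"
  obtains u where "\<And>i. i < k \<Longrightarrow> (\<Sum>j<Suc i. L i j * u j) = y i"
  using assms
proof (induction k arbitrary: thesis)
  case (Suc k)
  obtain u where u: "\<And>i. i < k \<Longrightarrow> (\<Sum>j<Suc i. L i j * u j) = y i"
    using Suc.IH Suc.prems(2) by auto
  define u' where "u' = u(k := (y k - (\<Sum>j<k. L k j * u j)) / L k k)"
  have "(\<Sum>j<Suc i. L i j * u' j) = y i" if "i < Suc k" for i
  proof (cases "i < k")
    case True
    then show ?thesis using u[OF True] by (simp add: u'_def)
  next
    case False
    then have "i = k" using that by simp
    then show ?thesis using Suc.prems(2)[of k] by (simp add: u'_def)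
  qed
  then show ?case by (rule Suc.prems(1))
qed simp

lemma cholesky_row_sum:
  assumes "cholesky m v L \<eta>" "i < m"
  shows "(\<Sum>j<m. L i j * u j) = (\<Sum>j<Suc i. L i j * u j)"
  using assms by (intro sum.mono_neutral_right) (auto simp: cholesky_def)

text \<open>The square roots telescope. The value \<open>c\<close> of the bottom diagonal entry
  never enters, because only indices below i <= m are multiplied.\<close>

lemma prod_cholesky_diag:
  assumes "i \<le> m"
  shows "(\<Prod>l<i. if l < m then \<eta> l * sqrt (psum u (Suc l) / psum u l) else c) =
    (\<Prod>l<i. \<eta> l) * sqrt (psum u i)"
  using assms
proof (induction i)
  case (Suc i)
  then show ?case by (simp add: real_sqrt_divide)
qed simp

text \<open>Induction on the size by bordering: since L is invertible, forward substitution writes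
  the last column of v as L u. Each prefix product is multiplied by some sqrt (psum u i) >= 1,
  whence the lower bound 1.\<close>

lemma cholesky_exists:
  fixes v :: "nat \<Rightarrow> nat \<Rightarrow> 'a::conj_normed_field"
  assumes "\<And>i. i < n \<Longrightarrow> v i i = 1" "\<And>i j. j < i \<Longrightarrow> i < n \<Longrightarrow> v i j = 0"
  obtains L \<eta> where "cholesky n v L \<eta>" "(\<Prod>l<n. \<eta> l) = 1" "\<And>i. i \<le> n \<Longrightarrow> 1 \<le> (\<Prod>l<i. \<eta> l)"
  using assms
proof (induction n arbitrary: thesis)
  case 0
  show ?case by (rule 0(1)[of "\<lambda>_ _. 0" "\<lambda>_. 1"]) (auto simp: cholesky_def)
next
  case (Suc n)
  obtain L \<eta> where L: "cholesky n v L \<eta>" "(\<Prod>l<n. \<eta> l) = 1"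
    and D: "\<And>i. i \<le> n \<Longrightarrow> 1 \<le> (\<Prod>l<i. \<eta> l)"
    using Suc.IH Suc.prems(2,3) by (metis less_Suc_eq)
  have "L i i \<noteq> 0" if "i < n" for i
    using L(1) that by (force simp: cholesky_def)
  then obtain u where u: "\<And>i. i < n \<Longrightarrow> (\<Sum>j<Suc i. L i j * u j) = v i n"
    using triangular_solve[of n L "\<lambda>i. v i n"] by blast
  have u': "v i n = (\<Sum>j<n. L i j * u j)" if "i < n" for i
    using u[OF that] cholesky_row_sum[OF L(1) that, of u] by simp
  define \<eta>' where "\<eta>' = (\<lambda>i. if i < n then \<eta> i * sqrt (psum u (Suc i) / psum u i) else 1 / sqrt (psum u n))"
  obtain L' where L': "cholesky (Suc n) v L' \<eta>'"
    using cholesky_Suc[of n v L \<eta> v u, OF L(1) refl u'] Suc.prems(2,3) unfolding \<eta>'_def by blast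
  have P: "(\<Prod>l<i. \<eta>' l) = (\<Prod>l<i. \<eta> l) * sqrt (psum u i)" if "i \<le> n" for i
    unfolding \<eta>'_def by (rule prod_cholesky_diag[OF that])
  have "(\<Prod>l<Suc n. \<eta>' l) = (\<Prod>l<n. \<eta>' l) * \<eta>' n" by simp
  \<comment> \<open>The bottom entry 1 / sqrt (psum u n) cancels the factor that the first n entries
    have gained together.\<close>
  then have P1: "(\<Prod>l<Suc n. \<eta>' l) = 1" using L(2) by (simp add: P) (simp add: \<eta>'_def)
  have "1 \<le> (\<Prod>l<i. \<eta>' l)" if "i \<le> Suc n" for i
  proof (cases "i \<le> n")
    case True
    have "1 * 1 \<le> (\<Prod>l<i. \<eta> l) * sqrt (psum u i)"
      using D[OF True] psum_ge_1[of u i] by (intro mult_mono) auto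
    then show ?thesis using P[OF True] by simp
  next
    case False
    then have "i = Suc n" using that by simp
    then show ?thesis using P1 by simp
  qed
  then show ?case using L' P1 Suc.prems(1) by blast
qed

text \<open>For \<open>v \<in> N\<close> with Iwasawa component \<open>a\<close> this is \<open>a\<close> raised to \<open>\<Lambda>\<^sub>i\<close>: writing \<open>v = m a k\<close>,
  the Gram matrix of the rows of \<open>v\<close> is \<open>m a\<^sup>2 m\<^sup>*\<close>.\<close>

definition gram_minor :: "nat \<Rightarrow> nat \<Rightarrow> (nat \<Rightarrow> nat \<Rightarrow> 'a::conj_normed_field) \<Rightarrow> real" where
  "gram_minor n i v =
    sqrt (norm (Determinant.det (mat i i (\<lambda>(p, q). \<Sum>l<n. v p l * conjugate (v q l)))))"

text \<open>For a lower triangular L the leading block of the Gram matrix is the leading block of L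
  times its own adjoint, so its determinant is the square of the prefix product. In particular these
  products depend on v only, not on the choice of L.\<close>

lemma gram_minor_cholesky:
  assumes L: "cholesky n v L \<eta>" and i: "i \<le> n"
  shows "gram_minor n i v = (\<Prod>l<i. \<eta> l)"
proof -
  define A where "A = mat i i (\<lambda>(p, q). L p q)"
  define B where "B = mat i i (\<lambda>(p, q). conjugate (L q p))"
  have AB: "A \<in> carrier_mat i i" "B \<in> carrier_mat i i" by (auto simp: A_def B_def)
  have eta: "L l l = of_real (\<eta> l)" "0 < \<eta> l" if "l < i" for l
    using L i that by (auto simp: cholesky_def)
  have tri: "L p q = 0" if "p < q" "q < n" for p q
    using L that by (auto simp: cholesky_def)
  have "mat i i (\<lambda>(p, q). \<Sum>l<n. v p l * conjugate (v q l)) = A * B"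
  proof (rule eq_matI)
    fix p q assume "p < dim_row (A * B)" "q < dim_col (A * B)"
    then have pq: "p < i" "q < i" by (auto simp: A_def B_def)
    have "(\<Sum>l<n. v p l * conjugate (v q l)) = (\<Sum>l<n. L p l * conjugate (L q l))"
      using L pq i by (auto simp: cholesky_def)
    also have "\<dots> = (\<Sum>l<i. L p l * conjugate (L q l))"
      using pq i by (intro sum.mono_neutral_right) (auto simp: tri)
    also have "\<dots> = (A * B) $$ (p, q)"
      using pq by (subst mat_mult_index[OF AB]) (auto simp: A_def B_def)
    finally show "mat i i (\<lambda>(p, q). \<Sum>l<n. v p l * conjugate (v q l)) $$ (p, q) = (A * B) $$ (p, q)"
      using pq by simp
  qed (auto simp: A_def B_def)
  moreover have "Determinant.det A = of_real (\<Prod>l<i. \<eta> l)"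
    by (subst det_lower_triangular[OF _ AB(1)])
       (use i in \<open>auto simp: A_def tri prod_list_diag_prod eta lessThan_atLeast0\<close>)
  moreover have "Determinant.det B = of_real (\<Prod>l<i. \<eta> l)"
    by (subst det_upper_triangular[OF _ AB(2)])
       (use i in \<open>auto simp: B_def upper_triangular_def tri prod_list_diag_prod eta lessThan_atLeast0\<close>)
  ultimately have "gram_minor n i v = sqrt (\<bar>\<Prod>l<i. \<eta> l\<bar> * \<bar>\<Prod>l<i. \<eta> l\<bar>)"
    by (simp add: gram_minor_def det_mult[OF AB] norm_mult del: of_real_prod)
  moreover have "0 \<le> (\<Prod>l<i. \<eta> l)" using eta by (intro prod_nonneg) (auto simp: less_imp_le)
  ultimately show ?thesis by simp
qed

section \<open>The Iwasawa component and its characters in terms of Gram minors\<close>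

lemma mat_adjoint_square:
  assumes "A \<in> carrier_mat n n"
  shows "mat_adjoint A = mat n n (\<lambda>(i, j). conjugate (A $$ (j, i)))"
  using assms by (intro eq_matI) (auto simp: mat_adjoint_def mat_of_rows_index)

lemma mat_adjoint_mult:
  assumes "A \<in> carrier_mat n n" "B \<in> carrier_mat n n"
  shows "mat_adjoint (A * B) = mat_adjoint B * mat_adjoint A"
proof (rule eq_matI)
  note adj = mat_adjoint_square[OF assms(1)] mat_adjoint_square[OF assms(2)]
    mat_adjoint_square[OF mult_carrier_mat[OF assms]]
  fix i j assume "i < dim_row (mat_adjoint B * mat_adjoint A)" "j < dim_col (mat_adjoint B * mat_adjoint A)"
  then have ij: "i < n" "j < n" by (auto simp: adj)
  have "(mat_adjoint B * mat_adjoint A) $$ (i, j) = (\<Sum>k<n. mat_adjoint B $$ (i, k) * mat_adjoint A $$ (k, j))"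
    by (rule mat_mult_index) (use ij in \<open>auto simp: adj\<close>)
  then show "mat_adjoint (A * B) $$ (i, j) = (mat_adjoint B * mat_adjoint A) $$ (i, j)"
    using ij mat_mult_index[OF assms ij(2,1)] by (simp add: adj conjugate_sum conjugate_dist_mul mult.commute)
qed (use assms in \<open>auto simp: mat_adjoint_square mat_adjoint_square[OF mult_carrier_mat[OF assms]]\<close>)

lemma mult_mat_adjoint_index:
  assumes "A \<in> carrier_mat n n" "i < n" "j < n"
  shows "(A * mat_adjoint A) $$ (i, j) = (\<Sum>l<n. A $$ (i, l) * conjugate (A $$ (j, l)))"
  by (subst mat_mult_index[of _ n]) (use assms in \<open>auto simp: mat_adjoint_square\<close>)

lemma unip_lower_iff:
  "m \<in> unip_lower n \<longleftrightarrow> m \<in> carrier_mat n n \<and> (\<forall>i<n. \<forall>j<n. i < j \<longrightarrow> m $$ (i, j) = 0) \<and>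
     (\<forall>i<n. m $$ (i, i) = (1 :: 'a::field))"
proof
  assume "m \<in> unip_lower n"
  then show "m \<in> carrier_mat n n \<and> (\<forall>i<n. \<forall>j<n. i < j \<longrightarrow> m $$ (i, j) = 0) \<and> (\<forall>i<n. m $$ (i, i) = 1)"
    by (auto simp: unip_lower_def unip_upper_iff)
next
  assume m: "m \<in> carrier_mat n n \<and> (\<forall>i<n. \<forall>j<n. i < j \<longrightarrow> m $$ (i, j) = 0) \<and> (\<forall>i<n. m $$ (i, i) = 1)"
  then have "m\<^sup>T \<in> unip_upper n" by (auto simp: unip_upper_iff)
  then have "(m\<^sup>T)\<^sup>T \<in> unip_lower n" unfolding unip_lower_def by (rule imageI)
  then show "m \<in> unip_lower n" by simp
qed

lemma prefix_prod_inj: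
  fixes \<eta> \<eta>' :: "nat \<Rightarrow> real"
  assumes "\<And>i. i \<le> n \<Longrightarrow> (\<Prod>l<i. \<eta> l) = (\<Prod>l<i. \<eta>' l)" "\<And>i. i < n \<Longrightarrow> 0 < \<eta> i" "l < n"
  shows "\<eta> l = \<eta>' l"
proof -
  have "(\<Prod>l<l. \<eta> l) > 0" using assms by (intro prod_pos) auto
  then have "(\<Prod>l<l. \<eta> l) \<noteq> 0" by linarith
  moreover have "(\<Prod>l<l. \<eta> l) * \<eta> l = (\<Prod>l<l. \<eta>' l) * \<eta>' l" "(\<Prod>l<l. \<eta> l) = (\<Prod>l<l. \<eta>' l)"
    using assms(1)[of "Suc l"] assms(1)[of l] assms(3) by auto
  ultimately show ?thesis by (metis mult_left_cancel)
qed

text \<open>Dividing the columns of L by the diagonal gives L = m a with m unipotent, and k = L^(-1)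
  v is unitary because v and L have the same Gram matrix.\<close>

lemma iwasawa_a_cholesky:
  fixes v :: "'a::conj_normed_field mat"
  assumes v: "v \<in> carrier (SL n)" and L: "cholesky n (\<lambda>i j. v $$ (i, j)) L \<eta>"
    and det1: "(\<Prod>l<n. \<eta> l) = 1"
  shows "iwasawa_a n v = mat_diag n (\<lambda>i. of_real (\<eta> i))" (is "_ = ?a")
    and "mat_diag n (\<lambda>i. of_real (\<eta> i)) \<in> (pos_diag n :: 'a mat set)"
proof -
  interpret group "SL n :: 'a mat monoid" by (rule group_SL)
  have vc: "v \<in> carrier_mat n n" using v by (simp add: carrier_SL)
  have eta: "0 < \<eta> i" "L i i = of_real (\<eta> i)" if "i < n" for i using L that by (auto simp: cholesky_def)
  have tri: "L i j = 0" if "i < j" "j < n" for i j using L that by (auto simp: cholesky_def)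
  have detd: "Determinant.det ?a = 1"
    by (subst det_upper_triangular[of _ n])
       (use det1 in \<open>auto simp: mat_diag_def prod_list_diag_prod lessThan_atLeast0 simp flip: of_real_prod\<close>)
  then show a: "?a \<in> (pos_diag n :: 'a mat set)"
    using eta by (auto simp: pos_diag_def carrier_SL diagonal_mat_def mat_diag_def)
  define M where "M = mat n n (\<lambda>(i, j). L i j)"
  define m where "m = mat n n (\<lambda>(i, j). L i j / of_real (\<eta> j))"
  have M: "M \<in> carrier_mat n n" by (simp add: M_def)
  have mM: "m * ?a = M"
    by (subst mat_diag_mult_right[of _ n])
       (use eta in \<open>auto simp: m_def M_def less_imp_neq[symmetric] intro!: eq_matI\<close>)
  have "Determinant.det M = of_real (\<Prod>l<n. \<eta> l)"
    by (subst det_lower_triangular[OF _ M])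
       (auto simp: M_def tri prod_list_diag_prod eta lessThan_atLeast0)
  then have MS: "M \<in> carrier (SL n)" using det1 M by (simp add: carrier_SL)
  define W where "W = inv\<^bsub>SL n\<^esub> M"
  have WS: "W \<in> carrier (SL n)" using MS by (simp add: W_def)
  then have W: "W \<in> carrier_mat n n" by (simp add: carrier_SL)
  have WM: "W * M = 1\<^sub>m n" "M * W = 1\<^sub>m n"
    using l_inv[OF MS] r_inv[OF MS] by (simp_all add: W_def mult_SL one_SL)
  have adjc: "mat_adjoint A \<in> carrier_mat n n" if "A \<in> carrier_mat n n" for A :: "'a mat"
    by (simp add: mat_adjoint_square[OF that])
  have gram: "v * mat_adjoint v = M * mat_adjoint M"
  proof (rule eq_matI)
    fix i j assume "i < dim_row (M * mat_adjoint M)" "j < dim_col (M * mat_adjoint M)"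
    then have ij: "i < n" "j < n" using M by (auto simp: mat_adjoint_square)
    then show "(v * mat_adjoint v) $$ (i, j) = (M * mat_adjoint M) $$ (i, j)"
      using L by (simp add: mult_mat_adjoint_index[OF vc] mult_mat_adjoint_index[OF M] cholesky_def)
         (simp add: M_def)
  qed (use vc M in \<open>auto simp: mat_adjoint_square\<close>)
  define k where "k = W * v"
  have kS: "k \<in> carrier (SL n)"
    using m_closed[OF WS v] by (simp add: k_def mult_SL)
  then have kc: "k \<in> carrier_mat n n" by (simp add: carrier_SL)
  have "k * mat_adjoint k = W * v * (mat_adjoint v * mat_adjoint W)"
    unfolding k_def mat_adjoint_mult[OF W vc] ..
  also have "\<dots> = W * (v * mat_adjoint v) * mat_adjoint W"
    using W vc adjc by (simp add: assoc_mult_mat[of _ n n _ n _ n] mult_carrier_mat[of _ n n])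
  also have "\<dots> = (W * M) * (mat_adjoint M * mat_adjoint W)"
    unfolding gram using W M adjc by (simp add: assoc_mult_mat[of _ n n _ n _ n] mult_carrier_mat[of _ n n])
  also have "\<dots> = 1\<^sub>m n * mat_adjoint (1\<^sub>m n)"
    by (simp add: mat_adjoint_mult[OF W M, symmetric] WM)
  also have "\<dots> = 1\<^sub>m n"
    by (intro eq_matI) (auto simp: mat_adjoint_square[of _ n] conjugate_of_real[of 1, simplified])
  finally have "mat_adjoint k * k = 1\<^sub>m n"
    by (rule mat_mult_left_right_inverse[OF kc adjc[OF kc]])
  then have kU: "k \<in> SU n" using kS by (simp add: SU_def)
  have "M * k = v"
    using W vc M WM by (simp add: k_def assoc_mult_mat[of _ n n _ n _ n, symmetric])
  then have ex: "v = m * ?a * k" by (simp add: mM)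
  have mN: "m \<in> unip_lower n"
    using eta by (auto simp: unip_lower_iff m_def tri less_imp_neq[symmetric])
  show "iwasawa_a n v = ?a"
    unfolding iwasawa_a_def
  proof (rule the_equality)
    show "?a \<in> pos_diag n \<and> (\<exists>m\<in>unip_lower n. \<exists>k\<in>SU n. v = m * ?a * k)"
      using a mN kU ex by blast
    fix b assume b: "b \<in> pos_diag n \<and> (\<exists>m\<in>unip_lower n. \<exists>k\<in>SU n. v = m * b * k)"
    then obtain m' k' where m': "m' \<in> unip_lower n" and k': "k' \<in> SU n" and v': "v = m' * b * k'" by blast
    obtain x where x: "\<And>i. i < n \<Longrightarrow> x i > 0 \<and> b $$ (i, i) = of_real (x i)"
      using b unfolding pos_diag_def mem_Collect_eq by metis
    have bc: "b \<in> carrier_mat n n" and dg: "\<And>i j. i < n \<Longrightarrow> j < n \<Longrightarrow> i \<noteq> j \<Longrightarrow> b $$ (i, j) = 0"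
      using b by (auto simp: pos_diag_def carrier_SL diagonal_mat_def)
    have beq: "b = mat_diag n (\<lambda>i. of_real (x i))"
      by (rule eq_matI) (use bc dg x in \<open>auto simp: mat_diag_def\<close>)
    have mc: "m' \<in> carrier_mat n n" using m' by (simp add: unip_lower_iff)
    have kc': "k' \<in> carrier_mat n n" using k' by (simp add: SU_def carrier_SL)
    have kk: "k' * mat_adjoint k' = 1\<^sub>m n"
      using k' by (intro mat_mult_left_right_inverse[OF adjc kc'] kc') (simp add: SU_def)
    \<comment> \<open>Uniqueness: for a second decomposition m' b k' the unitary factor drops out of
      the Gram matrix, so m' b is another Cholesky factor of v. Equal Gram minors give equal prefix
      products, hence equal diagonals.\<close>
    define C where "C = m' * b"
    have Cc: "C \<in> carrier_mat n n" using mc bc by (simp add: C_def)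
    have Ci: "C $$ (i, j) = m' $$ (i, j) * of_real (x j)" if "i < n" "j < n" for i j
      unfolding C_def beq by (subst mat_diag_mult_right[OF mc]) (use that in auto)
    have "v * mat_adjoint v = C * k' * (mat_adjoint k' * mat_adjoint C)"
      using v' by (simp add: C_def[symmetric] mat_adjoint_mult[OF Cc kc'])
    also have "\<dots> = C * (k' * mat_adjoint k') * mat_adjoint C"
      using Cc kc' adjc by (simp add: assoc_mult_mat[of _ n n _ n _ n] mult_carrier_mat[of _ n n])
    also have "\<dots> = C * mat_adjoint C" using Cc by (simp add: kk)
    finally have g: "v * mat_adjoint v = C * mat_adjoint C" .
    have "cholesky n (\<lambda>i j. v $$ (i, j)) (\<lambda>i j. C $$ (i, j)) x"
      unfolding cholesky_def
      by (intro conjI allI impI; (subst mult_mat_adjoint_index[OF vc, symmetric])?)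
         (use m' x in \<open>simp_all add: Ci unip_lower_iff g mult_mat_adjoint_index[OF Cc]\<close>)
    then have "(\<Prod>l<i. \<eta> l) = (\<Prod>l<i. x l)" if "i \<le> n" for i
      using gram_minor_cholesky[OF L that] gram_minor_cholesky[OF _ that] by metis
    then have "\<eta> l = x l" if "l < n" for l
      by (rule prefix_prod_inj[OF _ eta(1) that])
    then show "b = ?a" unfolding beq by (intro eq_matI) (auto simp: mat_diag_def)
  qed
qed

text \<open>When the full product is 1, this is the identity that twice rho, the sum of the positive
  roots, is twice the sum of the fundamental weights. The powers of the full product are carried
  along because the normalization is lost for shorter sequences in the induction.\<close>

lemma prod_pair_ratios:
  fixes \<eta> :: "nat \<Rightarrow> real"
  assumes "\<And>i. i < n \<Longrightarrow> 0 < \<eta> i"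
  shows "(\<Prod>j<n. \<Prod>i<j. \<eta> i / \<eta> j) * (\<Prod>l<n. \<eta> l) ^ n =
    (\<Prod>i<n. (\<Prod>l<i. \<eta> l))\<^sup>2 * (\<Prod>l<n. \<eta> l)"
  using assms
proof (induction n)
  case (Suc n)
  define p where "p = (\<Prod>l<n. \<eta> l)"
  have e: "\<eta> n > 0" using Suc.prems by simp
  have "(\<Prod>i<n. \<eta> i / \<eta> n) = p / \<eta> n ^ n" by (simp add: prod_dividef p_def)
  then have "(\<Prod>j<Suc n. \<Prod>i<j. \<eta> i / \<eta> j) * (\<Prod>l<Suc n. \<eta> l) ^ Suc n =
     ((\<Prod>j<n. \<Prod>i<j. \<eta> i / \<eta> j) * p ^ n) * p * (p * \<eta> n)"
    using e by (simp add: p_def[symmetric] power_mult_distrib)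
  also have "(\<Prod>j<n. \<Prod>i<j. \<eta> i / \<eta> j) * p ^ n = (\<Prod>i<n. (\<Prod>l<i. \<eta> l))\<^sup>2 * p"
    using Suc by (simp add: p_def)
  finally show ?case by (simp add: p_def[symmetric] power2_eq_square mult_ac)
qed simp

text \<open>From here on the group theory is gone: all characters are Gram minors of v, and these
  are at least 1. The exponent DIM('a) is the real dimension of each root space.\<close>

lemma iwasawa_characters:
  fixes v :: "'a::conj_normed_field mat"
  assumes v: "v \<in> unip_upper n"
  shows "k \<le> n \<Longrightarrow> Lambda k (iwasawa_a n v) = gram_minor n k (\<lambda>i j. v $$ (i, j))"
    and "rho n (iwasawa_a n v) = (\<Prod>i=1..<n. gram_minor n i (\<lambda>i j. v $$ (i, j)) ^ DIM('a))"
    and "k \<le> n \<Longrightarrow> 1 \<le> gram_minor n k (\<lambda>i j. v $$ (i, j))"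
proof -
  obtain L \<eta> where L: "cholesky n (\<lambda>i j. v $$ (i, j)) L \<eta>" and d: "(\<Prod>l<n. \<eta> l) = 1"
    and ge: "\<And>i. i \<le> n \<Longrightarrow> 1 \<le> (\<Prod>l<i. \<eta> l)"
    using cholesky_exists[of n "\<lambda>i j. v $$ (i, j)"] v by (metis unip_upper_iff)
  have eta: "0 < \<eta> i" if "i < n" for i using L that by (simp add: cholesky_def)
  have vS: "v \<in> carrier (SL n)" using v unip_upper_subset by blast
  note a = iwasawa_a_cholesky[OF vS L d]
  note gm = gram_minor_cholesky[OF L]
  show "Lambda k (iwasawa_a n v) = gram_minor n k (\<lambda>i j. v $$ (i, j))" if "k \<le> n"
  proof -
    have "Lambda k (iwasawa_a n v) = norm (of_real (\<Prod>l<k. \<eta> l) :: 'a)"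
      using that by (simp add: Lambda_def a(1) mat_diag_def)
    then show ?thesis using gm[OF that] ge[OF that] by (simp del: of_real_prod)
  qed
  show "1 \<le> gram_minor n k (\<lambda>i j. v $$ (i, j))" if "k \<le> n"
    using gm[OF that] ge[OF that] by simp
  define P where "P = (\<Prod>j<n. \<Prod>i<j. \<eta> i / \<eta> j)"
  define Q where "Q = (\<Prod>i<n. (\<Prod>l<i. \<eta> l))"
  have PQ: "P = Q\<^sup>2" using prod_pair_ratios[of n \<eta>] eta d by (simp add: P_def Q_def)
  have Q: "Q \<ge> 0" unfolding Q_def using eta by (intro prod_nonneg ballI) (auto intro: less_imp_le)
  have "det_Ad_lieN n (iwasawa_a n v) =
    (\<Prod>(i, j)\<in>{(i, j). i < j \<and> j < n}. (\<eta> i / \<eta> j) ^ DIM('a))"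
    unfolding det_Ad_lieN_eq[OF a(2), folded a(1)]
    using eta by (intro prod.cong) (auto simp: a(1) mat_diag_def less_imp_le)
  also have "\<dots> = (\<Prod>(j, i)\<in>(SIGMA j:{..<n}. {..<j}). (\<eta> i / \<eta> j) ^ DIM('a))"
    by (rule prod.reindex_bij_witness[of _ prod.swap prod.swap]) auto
  also have "\<dots> = P ^ DIM('a)"
    by (simp add: prod.Sigma[symmetric] P_def prod_power_distrib)
  finally have "rho n (iwasawa_a n v) = (P ^ DIM('a)) powr (1/2)"
    by (simp add: rho_def)
  also have "\<dots> = Q ^ DIM('a)"
    using Q by (simp add: PQ powr_half_sqrt power_mult[symmetric] mult.commute[of 2])
       (simp add: power_mult)
  also have "Q = (\<Prod>i=1..<n. \<Prod>l<i. \<eta> l)"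
    unfolding Q_def by (rule prod.mono_neutral_right) (auto simp: Suc_le_eq)
  also have "\<dots> = (\<Prod>i=1..<n. gram_minor n i (\<lambda>i j. v $$ (i, j)))"
    using gm by (intro prod.cong) auto
  finally show "rho n (iwasawa_a n v) = (\<Prod>i=1..<n. gram_minor n i (\<lambda>i j. v $$ (i, j)) ^ DIM('a))"
    by (simp add: prod_power_distrib)
qed

section \<open>Integrals of negative powers of 1 + |t|^2\<close>

lemma dyadic_shell:
  fixes x :: real
  obtains j :: nat where "x < 2 ^ Suc j" "(2 ^ j)\<^sup>2 \<le> 1 + x\<^sup>2"
proof -
  obtain n where "x < 2 ^ n" using real_arch_pow[of 2 x] by auto
  then have ex: "x < 2 ^ Suc n" by (rule less_le_trans) simp
  define j where "j = (LEAST j. x < 2 ^ Suc j)"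
  have 1: "x < 2 ^ Suc j" unfolding j_def using ex by (rule LeastI[of "\<lambda>j. x < 2 ^ Suc j"])
  have "(2 ^ j)\<^sup>2 \<le> 1 + x\<^sup>2"
  proof (cases j)
    case (Suc i)
    have "\<not> x < 2 ^ Suc i" using not_less_Least[of i "\<lambda>j. x < 2 ^ Suc j"] Suc by (simp add: j_def)
    then have "2 ^ j \<le> x" using Suc by simp
    then have "(2 ^ j)\<^sup>2 \<le> x\<^sup>2" by (intro power_mono) auto
    then show ?thesis by simp
  qed simp
  with 1 show thesis by (rule that)
qed

lemma powr_neg_antimono:
  fixes x y s :: real
  assumes "0 < x" "x \<le> y" "0 \<le> s"
  shows "y powr - s \<le> x powr - s"
  using assms by (intro powr_mono2') auto

text \<open>The ball of radius 2^(j+1) has volume of order 2^(j DIM('a)), while the integrand on the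
  j-th shell is at most 2^(-j (DIM('a) + 2 \<sigma>)). This leaves a geometric series of ratio 2^(-2
  \<sigma>).\<close>

lemma bracket_integral_finite:
  fixes \<sigma> :: real
  assumes "\<sigma> > 0"
  shows "(\<integral>\<^sup>+t. ennreal ((1 + (norm (t :: 'a::euclidean_space))\<^sup>2) powr - (real DIM('a) / 2 + \<sigma>)) \<partial>lborel) < \<infinity>"
proof -
  define s where "s = real DIM('a) / 2 + \<sigma>"
  define V where "V = unit_ball_vol (real DIM('a))"
  have V: "0 \<le> V" by (simp add: V_def)
  have s: "s > 0" using assms by (simp add: s_def)
  define c where "c j = 2 powr (- (2 * real j * s))" for j :: nat
  have "(\<integral>\<^sup>+t. ennreal ((1 + (norm (t :: 'a))\<^sup>2) powr - s) \<partial>lborel) \<le>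
    (\<integral>\<^sup>+t. (\<Sum>j. ennreal (c j) * indicator (ball 0 (2 ^ Suc j)) t) \<partial>(lborel :: 'a measure))"
  proof (rule nn_integral_mono)
    fix t :: 'a
    obtain j where j: "norm t < 2 ^ Suc j" "(2 ^ j)\<^sup>2 \<le> 1 + (norm t)\<^sup>2"
      by (rule dyadic_shell)
    have "(1 + (norm t)\<^sup>2) powr - s \<le> ((2 ^ j)\<^sup>2) powr - s"
      using j(2) s by (intro powr_neg_antimono) auto
    also have "((2::real) ^ j)\<^sup>2 = 2 powr (2 * real j)"
      using powr_realpow[of 2 "2 * j"] by (simp only: power_mult[symmetric] mult.commute[of j 2]) simp
    finally have "(1 + (norm t)\<^sup>2) powr - s \<le> c j"
      by (simp add: powr_powr c_def)
    then have "ennreal ((1 + (norm t)\<^sup>2) powr - s) \<le> ennreal (c j) * indicator (ball 0 (2 ^ Suc j)) t"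
      using j(1) by (simp add: ennreal_leI)
    also have "\<dots> \<le> (\<Sum>j. ennreal (c j) * indicator (ball 0 (2 ^ Suc j)) t)"
      using sum_le_suminf[of "\<lambda>j. ennreal (c j) * indicator (ball 0 (2 ^ Suc j)) t" "{j}"]
      by (simp del: sum_mult_indicator)
    finally show "ennreal ((1 + (norm t)\<^sup>2) powr - s) \<le> (\<Sum>j. ennreal (c j) * indicator (ball 0 (2 ^ Suc j)) t)" .
  qed
  also have "\<dots> = (\<Sum>j. \<integral>\<^sup>+t. ennreal (c j) * indicator (ball 0 (2 ^ Suc j)) t \<partial>(lborel :: 'a measure))"
    by (intro nn_integral_suminf borel_measurable_times_ennreal borel_measurable_indicator) auto
  also have "\<dots> = (\<Sum>j. ennreal (V * 2 ^ DIM('a) * (2 powr (- (2 * \<sigma>))) ^ j))"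
  proof (rule suminf_cong)
    fix j
    have "(\<integral>\<^sup>+t. ennreal (c j) * indicator (ball 0 (2 ^ Suc j)) t \<partial>(lborel :: 'a measure)) =
      ennreal (c j) * ennreal (V * (2 ^ Suc j) ^ DIM('a))"
      by (subst nn_integral_cmult_indicator) (simp_all add: emeasure_ball V_def)
    also have "\<dots> = ennreal (c j * (V * (2 ^ Suc j) ^ DIM('a)))"
      using V by (simp add: ennreal_mult c_def)
    also have "c j * (V * (2 ^ Suc j) ^ DIM('a)) = V * 2 ^ DIM('a) * (2 powr (- (2 * \<sigma>))) ^ j"
    proof -
      have "((2::real) ^ j) ^ DIM('a) = 2 powr (real j * real DIM('a))"
        using powr_realpow[of 2 "j * DIM('a)"] by (simp add: power_mult)
      moreover have "c j = 2 powr (- (real j * real DIM('a))) * 2 powr (- (2 * \<sigma>) * real j)"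
        unfolding c_def powr_add[symmetric] by (simp add: s_def algebra_simps)
      ultimately have "c j * ((2::real) ^ j) ^ DIM('a) = 2 powr (- (2 * \<sigma>) * real j)"
        by (simp add: powr_minus field_simps)
      also have "\<dots> = (2 powr (- (2 * \<sigma>))) ^ j"
        by (simp add: powr_power mult.commute)
      finally show ?thesis by (simp add: power_mult_distrib)
    qed
    finally show "(\<integral>\<^sup>+t. ennreal (c j) * indicator (ball 0 (2 ^ Suc j)) t \<partial>(lborel :: 'a measure)) =
      ennreal (V * 2 ^ DIM('a) * (2 powr (- (2 * \<sigma>))) ^ j)" .
  qed
  also have "\<dots> < \<infinity>"
  proof -
    have "2 powr (- (2 * \<sigma>)) < (2::real) powr 0" using assms by (intro powr_less_mono) auto
    then have "summable (\<lambda>j. V * 2 ^ DIM('a) * (2 powr (- (2 * \<sigma>))) ^ j)"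
      by (intro summable_mult summable_geometric) simp
    then show ?thesis
      using V by (subst suminf_ennreal2) auto
  qed
  finally show ?thesis by (simp add: s_def)
qed

definition bracket :: "real \<Rightarrow> 'a::real_normed_vector \<Rightarrow> real" where
  "bracket s t = (1 + (norm t)\<^sup>2) powr - s"

lemma bracket_nonneg [simp]: "0 \<le> bracket s t"
  by (simp add: bracket_def)

lemma bracket_le_1: "0 \<le> s \<Longrightarrow> bracket s t \<le> 1"
  using powr_neg_antimono[of 1 "1 + (norm t)\<^sup>2" s] by (simp add: bracket_def)

lemma bracket_measurable [measurable]:
  "f \<in> borel_measurable M \<Longrightarrow> (\<lambda>x. bracket s (f x :: 'a::euclidean_space)) \<in> borel_measurable M"
  unfolding bracket_def by measurable

lemma bracket_integral:
  assumes "\<sigma> > 0"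
  obtains I where "0 \<le> I" "(\<integral>\<^sup>+t. ennreal (bracket (real DIM('a) / 2 + \<sigma>) (t :: 'a::euclidean_space)) \<partial>lborel) = ennreal I"
proof -
  have "(\<integral>\<^sup>+t. ennreal (bracket (real DIM('a) / 2 + \<sigma>) (t :: 'a)) \<partial>lborel) < \<infinity>"
    unfolding bracket_def by (rule bracket_integral_finite[OF assms])
  then show thesis
    using that by (cases "\<integral>\<^sup>+t. ennreal (bracket (real DIM('a) / 2 + \<sigma>) (t :: 'a)) \<partial>lborel") auto
qed

text \<open>The decay in \<open>b\<close> comes from splitting at distance \<open>|b|\<^sup>-\<^sup>1\<^sup>/\<^sup>2\<close> from the zero of \<open>b t + s\<close>:
  inside, the volume is small, and outside, the second factor is.\<close>

lemma affine_bracket_integral: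
  fixes \<sigma> \<tau> :: real
  assumes \<sigma>: "\<sigma> > 0" and \<tau>: "0 < \<tau>" "\<tau> \<le> 1 / 2"
  obtains C where "0 \<le> C" "\<And>b s :: 'a::{real_normed_field, euclidean_space}.
    (\<integral>\<^sup>+t. ennreal (bracket (real DIM('a) / 2 + \<sigma>) t * bracket \<tau> (b * t + s)) \<partial>lborel)
      \<le> ennreal (C * (1 + (norm b)\<^sup>2) powr - (\<tau> / 2))"
proof -
  let ?f = "bracket (real DIM('a) / 2 + \<sigma>) :: 'a \<Rightarrow> real"
  obtain I where I: "0 \<le> I" "(\<integral>\<^sup>+t. ennreal (?f t) \<partial>lborel) = ennreal I"
    by (rule bracket_integral[OF \<sigma>])
  define V where "V = unit_ball_vol (real DIM('a))"
  have V: "0 \<le> V" by (simp add: V_def)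
  have f1: "?f t \<le> 1" for t using \<sigma> by (intro bracket_le_1) auto
  have half: "1 / 2 \<le> 2 powr - (\<tau> / 2)"
  proof -
    have "(2::real) powr - 1 \<le> 2 powr - (\<tau> / 2)" using \<tau> by (intro powr_mono) auto
    then show ?thesis by (simp add: powr_minus)
  qed
  have "(\<integral>\<^sup>+t. ennreal (?f t * bracket \<tau> (b * t + s)) \<partial>lborel)
      \<le> ennreal (2 * (I + V) * (1 + (norm b)\<^sup>2) powr - (\<tau> / 2))" for b s :: 'a
  proof (cases "norm b \<le> 1")
    case True
    have "(\<integral>\<^sup>+t. ennreal (?f t * bracket \<tau> (b * t + s)) \<partial>lborel) \<le> (\<integral>\<^sup>+t. ennreal (?f t) \<partial>lborel)"
      using \<tau> by (intro nn_integral_mono ennreal_leI mult_left_le bracket_le_1) auto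
    also have "\<dots> = ennreal I" by (rule I)
    also have "\<dots> \<le> ennreal (2 * (I + V) * (1 + (norm b)\<^sup>2) powr - (\<tau> / 2))"
    proof (rule ennreal_leI)
      have "(norm b)\<^sup>2 \<le> 1" using True by (simp add: power_le_one)
      then have "2 powr - (\<tau> / 2) \<le> (1 + (norm b)\<^sup>2) powr - (\<tau> / 2)"
        using \<tau> by (intro powr_neg_antimono) (auto intro: add_pos_nonneg)
      then have "1 / 2 \<le> (1 + (norm b)\<^sup>2) powr - (\<tau> / 2)" using half by linarith
      then have "2 * (I + V) * (1 / 2) \<le> 2 * (I + V) * (1 + (norm b)\<^sup>2) powr - (\<tau> / 2)"
        using I V by (intro mult_left_mono) auto
      then show "I \<le> 2 * (I + V) * (1 + (norm b)\<^sup>2) powr - (\<tau> / 2)" using V by simp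
    qed
    finally show ?thesis .
  next
    case False
    define \<beta> where "\<beta> = norm b"
    have \<beta>: "\<beta> > 1" using False by (simp add: \<beta>_def)
    have b0: "b \<noteq> 0" using \<beta> by (auto simp: \<beta>_def)
    define r where "r = \<beta> powr - (1 / 2)"
    \<comment> \<open>The assumption \<tau> <= 1/2 enters here: the volume of the exceptional ball
      is at most V * r, and r <= \<beta> powr - \<tau> is the decay that also holds outside the
      ball.\<close>
    have r: "0 < r" "r \<le> \<beta> powr - \<tau>" "r \<le> 1"
      using \<beta> \<tau> powr_mono[of "- (1/2)" "- \<tau>" \<beta>] powr_mono[of "- (1/2)" 0 \<beta>] by (auto simp: r_def)
    have pw: "ennreal (?f t * bracket \<tau> (b * t + s)) \<le>
      ennreal (\<beta> powr - \<tau>) * ennreal (?f t) + indicator (ball (- s / b) r) t" for t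
    proof (cases "t \<in> ball (- s / b) r")
      case True
      have "?f t * bracket \<tau> (b * t + s) \<le> 1"
        using f1[of t] bracket_le_1[of \<tau> "b * t + s"] \<tau> by (intro mult_le_one) auto
      then have "ennreal (?f t * bracket \<tau> (b * t + s)) \<le> 1" by (metis ennreal_1 ennreal_leI)
      then show ?thesis using True by (simp add: add_increasing)
    next
      case False
      then have "r \<le> norm (t + s / b)"
        by (simp add: dist_norm norm_minus_commute[of "- s / b"] not_less) 
           (metis diff_minus_eq_add minus_divide_left norm_minus_commute uminus_add_conv_diff add.commute minus_add_distrib)
      then have "\<beta> * r \<le> \<beta> * norm (t + s / b)" using \<beta> by simp
      also have "\<dots> = norm (b * t + s)"
        unfolding \<beta>_def norm_mult[symmetric] using b0 by (simp add: distrib_left)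
      finally have "(\<beta> * r)\<^sup>2 \<le> (norm (b * t + s))\<^sup>2"
        using \<beta> r by (intro power_mono) auto
      moreover have "(\<beta> * r)\<^sup>2 = \<beta>"
      proof -
        have "r\<^sup>2 = 1 / \<beta>" using \<beta> by (simp add: r_def powr_power powr_minus field_simps)
        then have "(\<beta> * r)\<^sup>2 = \<beta>\<^sup>2 * (1 / \<beta>)" by (simp only: power_mult_distrib)
        then show ?thesis using \<beta> by (simp add: power2_eq_square)
      qed
      ultimately have "bracket \<tau> (b * t + s) \<le> \<beta> powr - \<tau>"
        unfolding bracket_def using \<tau> \<beta> by (intro powr_neg_antimono) auto
      then have "?f t * bracket \<tau> (b * t + s) \<le> \<beta> powr - \<tau> * ?f t"
        by (subst mult.commute) (rule mult_right_mono, simp_all)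
      then show ?thesis
        by (simp add: add_increasing2 ennreal_leI flip: ennreal_mult')
    qed
    have "(\<integral>\<^sup>+t. ennreal (?f t * bracket \<tau> (b * t + s)) \<partial>lborel) \<le>
      (\<integral>\<^sup>+t. ennreal (\<beta> powr - \<tau>) * ennreal (?f t) + indicator (ball (- s / b) r) t \<partial>lborel)"
      by (intro nn_integral_mono pw)
    also have "\<dots> = ennreal (\<beta> powr - \<tau>) * ennreal I + ennreal (V * r ^ DIM('a))"
      using r(1) by (subst nn_integral_add) (auto simp: nn_integral_cmult I emeasure_ball V_def intro!: borel_measurable_indicator)
    also have "\<dots> = ennreal (\<beta> powr - \<tau> * I + V * r ^ DIM('a))"
      using I V r by (simp add: ennreal_mult ennreal_plus)
    also have "\<dots> \<le> ennreal (2 * (I + V) * (1 + (norm b)\<^sup>2) powr - (\<tau> / 2))"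
    proof (rule ennreal_leI)
      have "r ^ DIM('a) \<le> r ^ 1" using r by (intro power_decreasing) (auto simp: Suc_le_eq)
      then have "V * r ^ DIM('a) \<le> V * \<beta> powr - \<tau>" using r V by (intro mult_left_mono) auto
      then have "\<beta> powr - \<tau> * I + V * r ^ DIM('a) \<le> 2 * (I + V) * (1 / 2 * \<beta> powr - \<tau>)"
        by (simp add: algebra_simps)
      also have "\<dots> \<le> 2 * (I + V) * (1 + (norm b)\<^sup>2) powr - (\<tau> / 2)"
      proof (rule mult_left_mono)
        have "\<beta> powr - \<tau> = (\<beta>\<^sup>2) powr - (\<tau> / 2)"
          using \<beta> by (simp add: powr_powr flip: powr_numeral)
        then have "1 / 2 * \<beta> powr - \<tau> \<le> 2 powr - (\<tau> / 2) * (\<beta>\<^sup>2) powr - (\<tau> / 2)"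
          using half by (intro mult_mono) auto
        also have "\<dots> = (2 * \<beta>\<^sup>2) powr - (\<tau> / 2)" by (simp add: powr_mult)
        also have "\<dots> \<le> (1 + (norm b)\<^sup>2) powr - (\<tau> / 2)"
        proof (rule powr_neg_antimono)
          have "1 \<le> \<beta>\<^sup>2" using \<beta> by (simp add: one_le_power)
          then show "1 + (norm b)\<^sup>2 \<le> 2 * \<beta>\<^sup>2" by (simp add: \<beta>_def)
        qed (use \<tau> in \<open>auto intro: add_pos_nonneg\<close>)
        finally show "1 / 2 * \<beta> powr - \<tau> \<le> (1 + (norm b)\<^sup>2) powr - (\<tau> / 2)" .
      qed (use I V in auto)
      finally show "\<beta> powr - \<tau> * I + V * r ^ DIM('a) \<le> 2 * (I + V) * (1 + (norm b)\<^sup>2) powr - (\<tau> / 2)" .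
    qed
    finally show ?thesis .
  qed
  then show thesis using I V by (intro that[of "2 * (I + V)"]) auto
qed

interpretation lborel_product: product_sigma_finite "\<lambda>_. lborel :: 'a::euclidean_space measure"
  by unfold_locales

text \<open>For fixed values of the other coordinates the form is affine in the chosen one, and the
  affine bound is uniform in the constant term; each remaining coordinate contributes the finite
  factor I. Since the chosen coefficient is maximal, psum b k <= k * (1 + |b i|^2), which costs the
  constant k powr (\<tau> / 2).\<close>

lemma linear_form_bracket_integral:
  fixes \<sigma> \<tau> :: real and k :: nat
  assumes \<sigma>: "\<sigma> > 0" and \<tau>: "0 < \<tau>" "\<tau> \<le> 1 / 2" and k: "k > 0"
  obtains C where "0 \<le> C" "\<And>b :: nat \<Rightarrow> 'a::{real_normed_field, euclidean_space}.
    (\<integral>\<^sup>+u. ennreal ((\<Prod>j<k. bracket (real DIM('a) / 2 + \<sigma>) (u j)) * bracket \<tau> (\<Sum>j<k. b j * u j))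
        \<partial>Pi\<^sub>M {..<k} (\<lambda>_. lborel))
      \<le> ennreal (C * psum b k powr - (\<tau> / 2))"
proof -
  let ?f = "bracket (real DIM('a) / 2 + \<sigma>) :: 'a \<Rightarrow> real"
  obtain I where I: "0 \<le> I" "(\<integral>\<^sup>+t. ennreal (?f t) \<partial>lborel) = ennreal I"
    by (rule bracket_integral[OF \<sigma>])
  obtain C where C: "0 \<le> C" "\<And>b s :: 'a.
    (\<integral>\<^sup>+t. ennreal (?f t * bracket \<tau> (b * t + s)) \<partial>lborel) \<le> ennreal (C * (1 + (norm b)\<^sup>2) powr - (\<tau> / 2))"
    using affine_bracket_integral[OF \<sigma> \<tau>] by blast
  have "(\<integral>\<^sup>+u. ennreal ((\<Prod>j<k. ?f (u j)) * bracket \<tau> (\<Sum>j<k. b j * u j)) \<partial>Pi\<^sub>M {..<k} (\<lambda>_. lborel))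
      \<le> ennreal (I ^ (k - 1) * C * k powr (\<tau> / 2) * psum b k powr - (\<tau> / 2))" for b :: "nat \<Rightarrow> 'a"
  proof -
    have "Max ((\<lambda>j. norm (b j)) ` {..<k}) \<in> (\<lambda>j. norm (b j)) ` {..<k}"
      using k by (intro Max_in) auto
    then obtain i where i: "i < k" and im: "norm (b i) = Max ((\<lambda>j. norm (b j)) ` {..<k})" by force
    have max: "norm (b j) \<le> norm (b i)" if "j < k" for j
      unfolding im using that by (intro Max_ge) auto
    define K where "K = {..<k} - {i}"
    have K: "finite K" "i \<notin> K" "{..<k} = insert i K" using i by (auto simp: K_def)
    have card: "card K = k - 1" using i by (simp add: K_def)
    define c where "c = C * (1 + (norm (b i))\<^sup>2) powr - (\<tau> / 2)"
    have c: "0 \<le> c" using C by (simp add: c_def)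
    have fm: "?f \<in> borel_measurable borel" by simp
    have "(\<integral>\<^sup>+u. ennreal ((\<Prod>j<k. ?f (u j)) * bracket \<tau> (\<Sum>j<k. b j * u j)) \<partial>Pi\<^sub>M {..<k} (\<lambda>_. lborel)) =
      (\<integral>\<^sup>+u. \<integral>\<^sup>+t. ennreal ((\<Prod>j\<in>insert i K. ?f ((u(i := t)) j)) *
          bracket \<tau> (\<Sum>j\<in>insert i K. b j * (u(i := t)) j)) \<partial>lborel \<partial>Pi\<^sub>M K (\<lambda>_. lborel))"
      unfolding K(3) by (rule lborel_product.product_nn_integral_insert[OF K(1,2)]) measurable
    also have "\<dots> \<le> (\<integral>\<^sup>+u. ennreal c * (\<Prod>j\<in>K. ennreal (?f (u j))) \<partial>Pi\<^sub>M K (\<lambda>_. lborel))"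
    proof (rule nn_integral_mono)
      fix u :: "nat \<Rightarrow> 'a"
      define p where "p = (\<Prod>j\<in>K. ?f (u j))"
      have p: "0 \<le> p" by (simp add: p_def prod_nonneg)
      define s where "s = (\<Sum>j\<in>K. b j * u j)"
      have "(\<integral>\<^sup>+t. ennreal ((\<Prod>j\<in>insert i K. ?f ((u(i := t)) j)) *
          bracket \<tau> (\<Sum>j\<in>insert i K. b j * (u(i := t)) j)) \<partial>lborel) =
        (\<integral>\<^sup>+t. ennreal p * ennreal (?f t * bracket \<tau> (b i * t + s)) \<partial>lborel)"
      proof (intro nn_integral_cong)
        fix t
        have "(\<Prod>j\<in>K. ?f ((u(i := t)) j)) = p" "(\<Sum>j\<in>K. b j * (u(i := t)) j) = s"
          unfolding p_def s_def using K(2) by (auto intro!: prod.cong sum.cong)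
        then show "ennreal ((\<Prod>j\<in>insert i K. ?f ((u(i := t)) j)) *
          bracket \<tau> (\<Sum>j\<in>insert i K. b j * (u(i := t)) j)) = ennreal p * ennreal (?f t * bracket \<tau> (b i * t + s))"
          using K p by (simp add: ennreal_mult'[symmetric] mult_ac)
      qed
      also have "\<dots> = ennreal p * (\<integral>\<^sup>+t. ennreal (?f t * bracket \<tau> (b i * t + s)) \<partial>lborel)"
        by (rule nn_integral_cmult) measurable
      also have "\<dots> \<le> ennreal p * ennreal c"
        unfolding c_def by (intro mult_left_mono C) auto
      also have "\<dots> = ennreal c * (\<Prod>j\<in>K. ennreal (?f (u j)))"
        by (simp add: p_def prod_ennreal mult.commute)
      finally show "(\<integral>\<^sup>+t. ennreal ((\<Prod>j\<in>insert i K. ?f ((u(i := t)) j)) *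
          bracket \<tau> (\<Sum>j\<in>insert i K. b j * (u(i := t)) j)) \<partial>lborel) \<le> ennreal c * (\<Prod>j\<in>K. ennreal (?f (u j)))" .
    qed
    also have "\<dots> = ennreal c * (\<integral>\<^sup>+u. (\<Prod>j\<in>K. ennreal (?f (u j))) \<partial>Pi\<^sub>M K (\<lambda>_. lborel))"
      by (rule nn_integral_cmult) measurable
    also have "\<dots> = ennreal c * ennreal I ^ (k - 1)"
      by (subst lborel_product.product_nn_integral_prod[OF K(1)]) (simp_all add: I card)
    also have "\<dots> = ennreal (I ^ (k - 1) * c)"
      using I c by (simp add: ennreal_mult ennreal_power mult.commute)
    also have "\<dots> \<le> ennreal (I ^ (k - 1) * C * k powr (\<tau> / 2) * psum b k powr - (\<tau> / 2))"
    proof (rule ennreal_leI)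
      have "(\<Sum>j<k. (norm (b j))\<^sup>2) \<le> (\<Sum>j<k. (norm (b i))\<^sup>2)"
        using max by (intro sum_mono power_mono) auto
      moreover have "1 \<le> real k" using k by simp
      ultimately have "psum b k \<le> real k * (1 + (norm (b i))\<^sup>2)"
        by (simp add: psum_def distrib_left)
      then have "psum b k / real k \<le> 1 + (norm (b i))\<^sup>2"
        using k by (simp add: field_simps)
      then have "(1 + (norm (b i))\<^sup>2) powr - (\<tau> / 2) \<le> (psum b k / real k) powr - (\<tau> / 2)"
        using k \<tau> by (intro powr_neg_antimono) auto
      also have "\<dots> = k powr (\<tau> / 2) * psum b k powr - (\<tau> / 2)"
        using k by (simp add: powr_divide less_imp_le powr_minus field_simps)
      finally have "I ^ (k - 1) * C * (1 + (norm (b i))\<^sup>2) powr - (\<tau> / 2) \<le>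
        I ^ (k - 1) * C * (k powr (\<tau> / 2) * psum b k powr - (\<tau> / 2))"
        using I C by (intro mult_left_mono) auto
      then show "I ^ (k - 1) * c \<le> I ^ (k - 1) * C * k powr (\<tau> / 2) * psum b k powr - (\<tau> / 2)"
        by (simp add: c_def mult.assoc)
    qed
    finally show ?thesis .
  qed
  then show thesis using I C by (intro that[of "I ^ (k - 1) * C * k powr (\<tau> / 2)"]) auto
qed

lemma one_plus_norm_le_psum:
  assumes "j < i" shows "1 + (norm (u j))\<^sup>2 \<le> psum u i"
  using assms unfolding psum_def by (auto intro!: member_le_sum)

text \<open>The product alone has at best the critical exponent DIM('a) / 2 in each variable when
  \<epsilon> >= 0. The last factor is a negative power of h = 1 + |u|^2 + |b u|^2, which dominates 1
  + |u j|^2 for every j and also 1 + |b u|^2, so it can be shared among all of these. The bound is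
  uniform in b, and \<open>\<gamma>\<close> does not depend on \<epsilon>.\<close>

lemma psum_product_integral:
  fixes \<delta> :: real and k :: nat
  assumes \<delta>: "\<delta> > 0" and k: "k > 0"
  obtains \<epsilon>\<^sub>0 \<gamma> C where "0 < \<epsilon>\<^sub>0" "0 < \<gamma>" "0 \<le> C"
    "\<And>\<epsilon> (b :: nat \<Rightarrow> 'a::{real_normed_field, euclidean_space}). \<epsilon> \<le> \<epsilon>\<^sub>0 \<Longrightarrow>
      (\<integral>\<^sup>+u. ennreal ((\<Prod>j<k. psum u (Suc j) powr - (real DIM('a) / 2 * (1 - \<epsilon>))) *
          psum (u(k := \<Sum>j<k. b j * u j)) (Suc k) powr - (\<delta> / 2)) \<partial>Pi\<^sub>M {..<k} (\<lambda>_. lborel))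
        \<le> ennreal (C * psum b k powr - \<gamma>)"
proof -
  define d where "d = real DIM('a)"
  have d: "d > 0" by (simp add: d_def)
  \<comment> \<open>The exponent \<delta>/2 of h is split into halves. One half, \<delta>/4, is
    divided into k shares 2 \<sigma>; each share lifts the exponent of one coordinate to DIM('a)/2 *
    (1 - \<epsilon>) + 2 \<sigma>, and \<open>\<epsilon>\<^sub>0\<close> is chosen to keep this at
    least DIM('a)/2 + \<sigma>. The other half pays for \<open>bracket \<tau>\<close> of the linear
    form. The caps 1/2 and 1 serve the affine estimate and the sign of 1 - \<epsilon>.\<close>
  define \<tau> where "\<tau> = min (\<delta> / 4) (1 / 2)"
  have \<tau>: "0 < \<tau>" "\<tau> \<le> 1 / 2" "\<tau> \<le> \<delta> / 4" using \<delta> by (auto simp: \<tau>_def)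
  define \<sigma> where "\<sigma> = \<delta> / (8 * k)"
  have \<sigma>: "\<sigma> > 0" using \<delta> k by (simp add: \<sigma>_def)
  define \<epsilon>\<^sub>0 where "\<epsilon>\<^sub>0 = min 1 (2 * \<sigma> / d)"
  obtain C where C: "0 \<le> C" "\<And>b :: nat \<Rightarrow> 'a.
    (\<integral>\<^sup>+u. ennreal ((\<Prod>j<k. bracket (real DIM('a) / 2 + \<sigma>) (u j)) * bracket \<tau> (\<Sum>j<k. b j * u j))
        \<partial>Pi\<^sub>M {..<k} (\<lambda>_. lborel)) \<le> ennreal (C * psum b k powr - (\<tau> / 2))"
    using linear_form_bracket_integral[OF \<sigma> \<tau>(1,2) k] by blast
  have pw: "(\<Prod>j<k. psum u (Suc j) powr - (d / 2 * (1 - \<epsilon>))) *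
          psum (u(k := z)) (Suc k) powr - (\<delta> / 2)
      \<le> (\<Prod>j<k. bracket (d / 2 + \<sigma>) (u j)) * bracket \<tau> z"
    if \<epsilon>: "\<epsilon> \<le> \<epsilon>\<^sub>0" for \<epsilon> and u :: "nat \<Rightarrow> 'a" and z
  proof -
    define h where "h = psum (u(k := z)) (Suc k)"
    have h1: "1 + (norm (u j))\<^sup>2 \<le> h" if "j < k" for j
      using one_plus_norm_le_psum[of j "Suc k" "u(k := z)"] that by (simp add: h_def)
    have hz: "1 + (norm z)\<^sup>2 \<le> h"
      using one_plus_norm_le_psum[of k "Suc k" "u(k := z)"] by (simp add: h_def)
    have h: "h \<ge> 1" using psum_ge_1 by (simp add: h_def)
    have e1: "\<epsilon> \<le> 1" and e2: "d * \<epsilon> \<le> 2 * \<sigma>"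
      using \<epsilon> d by (auto simp: \<epsilon>\<^sub>0_def field_simps)
    have "h powr - (\<delta> / 4) \<le> h powr - \<tau>" using h \<tau> by (intro powr_mono) auto
    also have "\<dots> \<le> bracket \<tau> z"
      unfolding bracket_def using hz \<tau> by (intro powr_neg_antimono) (auto intro: add_pos_nonneg)
    finally have A: "h powr - (\<delta> / 4) \<le> bracket \<tau> z" .
    have "h powr - (\<delta> / 4) = (\<Prod>j<k. h powr - (2 * \<sigma>))"
      using h k by (simp add: powr_power \<sigma>_def)
    then have B: "(\<Prod>j<k. psum u (Suc j) powr - (d / 2 * (1 - \<epsilon>))) * h powr - (\<delta> / 4)
      = (\<Prod>j<k. psum u (Suc j) powr - (d / 2 * (1 - \<epsilon>)) * h powr - (2 * \<sigma>))"
      by (simp add: prod.distrib)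
    also have "\<dots> \<le> (\<Prod>j<k. bracket (d / 2 + \<sigma>) (u j))"
    proof (intro prod_mono conjI)
      fix j assume "j \<in> {..<k}"
      then have j: "j < k" by simp
      define y where "y = 1 + (norm (u j))\<^sup>2"
      have y: "1 \<le> y" by (simp add: y_def)
      have "psum u (Suc j) powr - (d / 2 * (1 - \<epsilon>)) * h powr - (2 * \<sigma>) \<le>
        y powr - (d / 2 * (1 - \<epsilon>)) * y powr - (2 * \<sigma>)"
        using e1 d \<sigma> y h1[OF j] one_plus_norm_le_psum[of j "Suc j" u]
        by (intro mult_mono powr_neg_antimono) (auto simp: y_def intro: add_pos_nonneg)
      also have "\<dots> \<le> y powr - (d / 2 + \<sigma>)"
        unfolding powr_add[symmetric] using y e2 by (intro powr_mono) (auto simp: field_simps)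
      finally show "psum u (Suc j) powr - (d / 2 * (1 - \<epsilon>)) * h powr - (2 * \<sigma>) \<le> bracket (d / 2 + \<sigma>) (u j)"
        by (simp add: bracket_def y_def)
    qed simp
    finally have B': "(\<Prod>j<k. psum u (Suc j) powr - (d / 2 * (1 - \<epsilon>))) * h powr - (\<delta> / 4)
      \<le> (\<Prod>j<k. bracket (d / 2 + \<sigma>) (u j))" .
    have "h powr - (\<delta> / 2) = h powr - (\<delta> / 4) * h powr - (\<delta> / 4)"
      by (simp add: powr_add[symmetric])
    then have "(\<Prod>j<k. psum u (Suc j) powr - (d / 2 * (1 - \<epsilon>))) * h powr - (\<delta> / 2) =
      ((\<Prod>j<k. psum u (Suc j) powr - (d / 2 * (1 - \<epsilon>))) * h powr - (\<delta> / 4)) * h powr - (\<delta> / 4)"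
      by simp
    also have "\<dots> \<le> (\<Prod>j<k. bracket (d / 2 + \<sigma>) (u j)) * bracket \<tau> z"
      using A B' by (intro mult_mono) (auto intro!: prod_nonneg)
    finally show ?thesis by (simp add: h_def)
  qed
  show thesis
  proof (rule that[of \<epsilon>\<^sub>0 "\<tau> / 2" C])
    show "0 < \<epsilon>\<^sub>0" using \<sigma> d by (simp add: \<epsilon>\<^sub>0_def)
    fix \<epsilon> and b :: "nat \<Rightarrow> 'a" assume "\<epsilon> \<le> \<epsilon>\<^sub>0"
    then show "(\<integral>\<^sup>+u. ennreal ((\<Prod>j<k. psum u (Suc j) powr - (real DIM('a) / 2 * (1 - \<epsilon>))) *
          psum (u(k := \<Sum>j<k. b j * u j)) (Suc k) powr - (\<delta> / 2)) \<partial>Pi\<^sub>M {..<k} (\<lambda>_. lborel))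
        \<le> ennreal (C * psum b k powr - (\<tau> / 2))"
      using pw unfolding d_def by (intro order_trans[OF nn_integral_mono C(2)] ennreal_leI)
  qed (use C \<tau> in auto)
qed

section \<open>Triangular change of variables\<close>

lemma nn_integral_lborel_affine:
  fixes a :: "'a::euclidean_space" and c :: real
  assumes "c > 0" and g[measurable]: "g \<in> borel_measurable borel"
  shows "(\<integral>\<^sup>+t. g t \<partial>lborel) = ennreal (c ^ DIM('a)) * (\<integral>\<^sup>+s. g (a + c *\<^sub>R s) \<partial>lborel)"
  using assms
  by (subst lborel_affine[of c a])
     (auto simp: nn_integral_density nn_integral_distr nn_integral_cmult)

text \<open>One variable at a time: the k-th coordinate of L u is affine in u k with slope \<eta> k
  and a shift depending only on earlier variables. The injection \<open>p\<close> with left inverse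
  \<open>r\<close> allows y to be indexed by matrix positions; it will be applied to p i = (i, Suc
  k) and r = fst.\<close>

lemma triangular_substitution:
  fixes L :: "nat \<Rightarrow> nat \<Rightarrow> 'a::{real_normed_field, euclidean_space}" and p :: "nat \<Rightarrow> 'i" and r :: "'i \<Rightarrow> nat"
  assumes "\<And>i. i < k \<Longrightarrow> 0 < \<eta> i" "\<And>i. i < k \<Longrightarrow> L i i = of_real (\<eta> i)"
    and rp: "\<And>i. r (p i) = i"
    and "F \<in> borel_measurable (Pi\<^sub>M (p ` {..<k}) (\<lambda>_. lborel))"
  shows "(\<integral>\<^sup>+y. F y \<partial>Pi\<^sub>M (p ` {..<k}) (\<lambda>_. lborel)) =
    ennreal ((\<Prod>i<k. \<eta> i) ^ DIM('a)) *
    (\<integral>\<^sup>+u. F (\<lambda>q\<in>p ` {..<k}. \<Sum>j<Suc (r q). L (r q) j * u j) \<partial>Pi\<^sub>M {..<k} (\<lambda>_. lborel))"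
  using assms(1,2,4)
proof (induction k arbitrary: F)
  case 0
  show ?case by (simp add: restrict_def PiM_empty nn_integral_count_space_finite)
next
  case (Suc k)
  define T where "T u = (\<lambda>q\<in>p ` {..<k}. \<Sum>j<Suc (r q). L (r q) j * u j)" for u
  define T' where "T' u = (\<lambda>q\<in>p ` {..<Suc k}. \<Sum>j<Suc (r q). L (r q) j * u j)" for u
  have img: "p ` {..<Suc k} = insert (p k) (p ` {..<k})" by (auto simp: less_Suc_eq)
  have nin: "p k \<notin> p ` {..<k}" using rp by (metis imageE lessThan_iff less_irrefl)
  have F[measurable]: "F \<in> borel_measurable (Pi\<^sub>M (insert (p k) (p ` {..<k})) (\<lambda>_. lborel))"
    using Suc.prems(3) unfolding img .
  have eta: "\<eta> k > 0" "L k k = of_real (\<eta> k)" using Suc.prems by auto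
  have comp: "(\<lambda>u. u j) \<in> borel_measurable (Pi\<^sub>M J (\<lambda>_. lborel :: 'a measure))" if "j \<in> J" for j :: nat and J
    using measurable_component_singleton[OF that, of "\<lambda>_. lborel :: 'a measure"] by simp
  have Tm[measurable]: "T \<in> Pi\<^sub>M {..<k} (\<lambda>_. lborel) \<rightarrow>\<^sub>M Pi\<^sub>M (p ` {..<k}) (\<lambda>_. lborel)"
    unfolding T_def
  proof (rule measurable_restrict)
    fix q assume "q \<in> p ` {..<k}"
    then have "r q < k" using rp by auto
    then show "(\<lambda>u. \<Sum>j<Suc (r q). L (r q) j * u j) \<in> Pi\<^sub>M {..<k} (\<lambda>_. lborel) \<rightarrow>\<^sub>M lborel"
      by (auto simp del: sum.lessThan_Suc intro!: borel_measurable_sum borel_measurable_times comp)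
  qed
  have T'm[measurable]: "T' \<in> Pi\<^sub>M (insert k {..<k}) (\<lambda>_. lborel) \<rightarrow>\<^sub>M Pi\<^sub>M (insert (p k) (p ` {..<k})) (\<lambda>_. lborel)"
    unfolding T'_def img
  proof (rule measurable_restrict)
    fix q assume "q \<in> insert (p k) (p ` {..<k})"
    then have "r q < Suc k" using rp by auto
    then show "(\<lambda>u. \<Sum>j<Suc (r q). L (r q) j * u j) \<in> Pi\<^sub>M (insert k {..<k}) (\<lambda>_. lborel) \<rightarrow>\<^sub>M lborel"
      by (auto simp del: sum.lessThan_Suc intro!: borel_measurable_sum borel_measurable_times comp)
  qed
  have T'T: "T' (u(k := s)) = (T u)(p k := (\<Sum>j<k. L k j * u j) + \<eta> k *\<^sub>R s)" for u s
  proof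
    fix q
    consider "q = p k" | i where "i < k" "q = p i" | "q \<noteq> p k" "q \<notin> p ` {..<k}"
      by auto
    then show "T' (u(k := s)) q = ((T u)(p k := (\<Sum>j<k. L k j * u j) + \<eta> k *\<^sub>R s)) q"
    proof cases
      case 1
      then show ?thesis by (simp add: T'_def rp eta scaleR_conv_of_real)
    next
      case 2
      then have "p i \<noteq> p k" using rp by (metis less_irrefl)
      with 2 show ?thesis by (simp add: T'_def T_def rp)
    next
      case 3
      then show ?thesis by (auto simp: T'_def T_def img)
    qed
  qed
  define P where "P = (\<Prod>i<k. \<eta> i)"
  have P: "0 \<le> P" unfolding P_def using Suc.prems by (intro prod_nonneg) (auto intro: less_imp_le)
  have um: "(\<lambda>(u, t). u(p k := t)) \<in> Pi\<^sub>M (p ` {..<k}) (\<lambda>_. lborel) \<Otimes>\<^sub>M (lborel :: 'a measure) \<rightarrow>\<^sub>M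
    Pi\<^sub>M (insert (p k) (p ` {..<k})) (\<lambda>_. lborel)"
    using measurable_add_dim[of "p k" "p ` {..<k}" "\<lambda>_. lborel :: 'a measure"]
    by (simp add: case_prod_beta')
  have "(\<lambda>(a, t). F (a(p k := t))) \<in> borel_measurable (Pi\<^sub>M (p ` {..<k}) (\<lambda>_. lborel) \<Otimes>\<^sub>M (lborel :: 'a measure))"
    using measurable_compose[OF um F] by (simp add: case_prod_beta')
  \<comment> \<open>The induction hypothesis is applied to F with its last coordinate integrated
    out, so that inner integral must be measurable in the earlier coordinates.\<close>
  note Fm = lborel.borel_measurable_nn_integral[OF this]
  have "(\<integral>\<^sup>+y. F y \<partial>Pi\<^sub>M (p ` {..<Suc k}) (\<lambda>_. lborel)) =
    (\<integral>\<^sup>+y. \<integral>\<^sup>+t. F (y(p k := t)) \<partial>lborel \<partial>Pi\<^sub>M (p ` {..<k}) (\<lambda>_. lborel))"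
    unfolding img using nin by (intro lborel_product.product_nn_integral_insert F) auto
  also have "\<dots> = ennreal (P ^ DIM('a)) *
    (\<integral>\<^sup>+u. \<integral>\<^sup>+t. F ((T u)(p k := t)) \<partial>lborel \<partial>Pi\<^sub>M {..<k} (\<lambda>_. lborel))"
    unfolding T_def P_def using Suc.prems(1,2) by (intro Suc.IH Fm) simp_all
  also have "(\<integral>\<^sup>+u. \<integral>\<^sup>+t. F ((T u)(p k := t)) \<partial>lborel \<partial>Pi\<^sub>M {..<k} (\<lambda>_. lborel)) =
    (\<integral>\<^sup>+u. ennreal (\<eta> k ^ DIM('a)) * (\<integral>\<^sup>+s. F (T' (u(k := s))) \<partial>lborel) \<partial>Pi\<^sub>M {..<k} (\<lambda>_. lborel))"
  proof (rule nn_integral_cong)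
    fix u :: "nat \<Rightarrow> 'a" assume "u \<in> space (Pi\<^sub>M {..<k} (\<lambda>_. lborel))"
    then have "T u \<in> space (Pi\<^sub>M (p ` {..<k}) (\<lambda>_. lborel))" by (rule measurable_space[OF Tm])
    then have "(\<lambda>t. (T u)(p k := t)) \<in> lborel \<rightarrow>\<^sub>M Pi\<^sub>M (insert (p k) (p ` {..<k})) (\<lambda>_. lborel)"
      using nin by (intro measurable_component_update) auto
    from measurable_compose[OF this F]
    show "(\<integral>\<^sup>+t. F ((T u)(p k := t)) \<partial>lborel) = ennreal (\<eta> k ^ DIM('a)) * (\<integral>\<^sup>+s. F (T' (u(k := s))) \<partial>lborel)"
      unfolding T'T by (intro nn_integral_lborel_affine eta) simp
  qed
  also have "\<dots> = ennreal (\<eta> k ^ DIM('a)) *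
    (\<integral>\<^sup>+u. \<integral>\<^sup>+s. F (T' (u(k := s))) \<partial>lborel \<partial>Pi\<^sub>M {..<k} (\<lambda>_. lborel))"
    by (rule nn_integral_cmult) measurable
  also have "(\<integral>\<^sup>+u. \<integral>\<^sup>+s. F (T' (u(k := s))) \<partial>lborel \<partial>Pi\<^sub>M {..<k} (\<lambda>_. lborel)) =
    (\<integral>\<^sup>+u. F (T' u) \<partial>Pi\<^sub>M (insert k {..<k}) (\<lambda>_. lborel))"
    by (rule lborel_product.product_nn_integral_insert[symmetric]) auto
  also have "insert k {..<k} = {..<Suc k}" by auto
  finally show ?case
    using P eta(1) unfolding T'_def P_def
    by (simp add: mult.assoc[symmetric] ennreal_mult'[symmetric] power_mult_distrib)
qed

section \<open>Minors as functions of the free entries, and the effect of a new last column\<close>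

definition entry_minor :: "nat \<Rightarrow> nat \<Rightarrow> (nat \<times> nat \<Rightarrow> 'a::conj_normed_field) \<Rightarrow> real" where
  "entry_minor n i x = gram_minor n i (\<lambda>p q. of_entries n x $$ (p, q))"

lemma of_entries_unip: "of_entries n x \<in> unip_upper n"
  using of_entries_in[of n x] by (simp add: commN_eq)

lemma entry_minor_ge_1: "i \<le> n \<Longrightarrow> 1 \<le> entry_minor n i x"
  unfolding entry_minor_def by (rule iwasawa_characters(3)[OF of_entries_unip])

lemma norm_conjugate [simp]: "norm (conjugate x) = norm (x :: 'a::conj_normed_field)"
proof (cases "x = 0")
  case False
  have "norm x * norm (conjugate x) = (norm x)\<^sup>2"
    using arg_cong[OF mult_conjugate[of x], of norm] by (simp add: norm_mult del: of_real_power)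
  then show ?thesis using False by (simp add: power2_eq_square)
qed simp

lemma borel_measurable_conjugate [measurable]:
  "conjugate \<in> borel_measurable (borel :: 'a::conj_normed_field measure)"
proof (rule borel_measurable_continuous_onI)
  have "dist (conjugate x) (conjugate y) = dist x (y :: 'a)" for x y
  proof -
    have "conjugate x - conjugate y = conjugate (x - y)"
      using conjugate_dist_add[of x "- y"] by (simp add: conjugate_neg)
    then show ?thesis by (simp add: dist_norm)
  qed
  then show "continuous_on UNIV (conjugate :: 'a \<Rightarrow> 'a)"
    unfolding continuous_on_iff by metis
qed

text \<open>By the Leibniz formula the minor is the square root of the norm of a polynomial in the
  entries and their conjugates.\<close>

lemma entry_minor_measurable:
  assumes i: "i \<le> n"
  shows "entry_minor n i \<in> borel_measurable (Pi\<^sub>M (free_entries n) (\<lambda>_. lborel :: 'a::conj_normed_field measure))"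
proof -
  let ?M = "Pi\<^sub>M (free_entries n) (\<lambda>_. lborel :: 'a measure)"
  define g where "g x p q = (\<Sum>l<n. of_entries n x $$ (p, l) * conjugate (of_entries n x $$ (q, l)))" for x :: "nat \<times> nat \<Rightarrow> 'a" and p q
  have e: "(\<lambda>x. of_entries n x $$ (p, q)) \<in> borel_measurable ?M" if "p < n" "q < n" for p q
  proof -
    have "(\<lambda>x. x (p, q)) \<in> borel_measurable ?M" if "p + 1 < q"
      using measurable_component_singleton[of "(p, q)" "free_entries n" "\<lambda>_. lborel :: 'a measure"] that \<open>q < n\<close>
      by (simp add: free_entries_def)
    then show ?thesis using that by (cases "p = q"; cases "p + 1 < q") (simp_all add: of_entries_def)
  qed
  have g: "(\<lambda>x. g x p q) \<in> borel_measurable ?M" if "p < n" "q < n" for p q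
    unfolding g_def using that
    by (intro borel_measurable_sum borel_measurable_times measurable_compose[OF _ borel_measurable_conjugate] e) auto
  have "Determinant.det (mat i i (\<lambda>(p, q). g x p q)) =
    (\<Sum>p | p permutes {0..<i}. signof p * (\<Prod>a = 0..<i. g x a (p a)))" for x
    unfolding det_def by (auto intro!: sum.cong prod.cong simp: permutes_in_image[of _ "{0..<i}", simplified])
  then have "entry_minor n i = (\<lambda>x. sqrt (norm (\<Sum>p | p permutes {0..<i}. signof p * (\<Prod>a = 0..<i. g x a (p a)))))"
    unfolding entry_minor_def gram_minor_def g_def by (intro ext) simp
  moreover have "(\<lambda>x. signof p * (\<Prod>a = 0..<i. g x a (p a))) \<in> borel_measurable ?M"
    if "p permutes {0..<i}" for p
  proof (intro borel_measurable_times borel_measurable_prod g)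
    fix a assume "a \<in> {0..<i}"
    then show "a < n" "p a < n"
      using i permutes_in_image[OF that, of a] by auto
  qed auto
  ultimately show ?thesis by simp
qed

text \<open>The new column is free in rows below index k only; in row k it meets the superdiagonal
  and vanishes. Row k of L u = 0 determines the coordinate at k as the stated linear form, while the
  rows i < k do not see that coordinate.\<close>

lemma entry_minor_Suc:
  fixes x x' :: "nat \<times> nat \<Rightarrow> 'a::conj_normed_field"
  assumes L: "cholesky (Suc k) (\<lambda>p q. of_entries (Suc k) x $$ (p, q)) L \<eta>"
    and old: "\<And>q. q \<in> free_entries (Suc k) \<Longrightarrow> x' q = x q"
    and new: "\<And>i. i < k \<Longrightarrow> x' (i, Suc k) = (\<Sum>j<Suc i. L i j * u j)"
    and i: "i \<le> Suc k"
  shows "entry_minor (Suc (Suc k)) i x' =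
    (\<Prod>l<i. \<eta> l) * sqrt (psum (u(k := \<Sum>j<k. - (L k j / of_real (\<eta> k)) * u j)) i)"
proof -
  define w where "w = u(k := \<Sum>j<k. - (L k j / of_real (\<eta> k)) * u j)"
  have eta: "0 < \<eta> k" "L k k = of_real (\<eta> k)" using L by (auto simp: cholesky_def)
  have "(\<Sum>j<Suc k. L l j * w j) = of_entries (Suc (Suc k)) x' $$ (l, Suc k)" if l: "l < Suc k" for l
  proof (cases "l < k")
    case True
    have "(\<Sum>j<Suc k. L l j * w j) = (\<Sum>j<Suc l. L l j * w j)"
      by (rule cholesky_row_sum[OF L l])
    also have "\<dots> = (\<Sum>j<Suc l. L l j * u j)"
      using True by (intro sum.cong) (auto simp: w_def)
    finally show ?thesis using True new by (simp add: of_entries_def)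
  next
    case False
    then have "l = k" using l by simp
    moreover have "(\<Sum>j<k. L k j * w j) = (\<Sum>j<k. L k j * u j)"
      by (intro sum.cong) (auto simp: w_def)
    moreover have "of_real (\<eta> k) * w k = - (\<Sum>j<k. L k j * u j)"
      using eta(1) by (simp add: w_def sum_distrib_left sum_negf)
    ultimately show ?thesis by (simp add: eta of_entries_def)
  qed
  then obtain L' where L': "cholesky (Suc (Suc k)) (\<lambda>p q. of_entries (Suc (Suc k)) x' $$ (p, q)) L'
    (\<lambda>i. if i < Suc k then \<eta> i * sqrt (psum w (Suc i) / psum w i) else 1 / sqrt (psum w (Suc k)))"
    by (rule_tac cholesky_Suc[OF L, of "\<lambda>p q. of_entries (Suc (Suc k)) x' $$ (p, q)" w])
       (auto simp: of_entries_def old free_entries_def)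
  show ?thesis
    unfolding entry_minor_def w_def[symmetric] gram_minor_cholesky[OF L' le_SucI[OF i]]
    by (rule prod_cholesky_diag[OF i])
qed

text \<open>The last row of a unipotent upper triangular matrix is a unit vector, so the last row of
  L has norm 1. Thus 1 + |b|^2 = 1 / (\<eta> k)^2, and 1 / \<eta> k is the product of the other
  diagonal entries because all of them multiply to 1.\<close>

lemma psum_last_row:
  fixes x :: "nat \<times> nat \<Rightarrow> 'a::conj_normed_field"
  assumes L: "cholesky (Suc k) (\<lambda>p q. of_entries (Suc k) x $$ (p, q)) L \<eta>"
    and d: "(\<Prod>l<Suc k. \<eta> l) = 1"
  shows "psum (\<lambda>j. - (L k j / of_real (\<eta> k))) k = (entry_minor (Suc k) k x)\<^sup>2"
proof -
  have eta: "0 < \<eta> k" "L k k = of_real (\<eta> k)" using L by (auto simp: cholesky_def)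
  have "(\<Sum>l<Suc k. of_entries (Suc k) x $$ (k, l) * conjugate (of_entries (Suc k) x $$ (k, l))) =
    (\<Sum>l<Suc k. L k l * conjugate (L k l))"
    using L unfolding cholesky_def by blast
  moreover have "(\<Sum>l<Suc k. of_entries (Suc k) x $$ (k, l) * conjugate (of_entries (Suc k) x $$ (k, l))) = 1"
  proof -
    have "(\<Sum>l<k. of_entries (Suc k) x $$ (k, l) * conjugate (of_entries (Suc k) x $$ (k, l))) = 0"
      by (intro sum.neutral) (auto simp: of_entries_def)
    then show ?thesis by (simp add: of_entries_def conjugate_of_real[of 1, simplified])
  qed
  ultimately have "(of_real (\<Sum>l<Suc k. (norm (L k l))\<^sup>2) :: 'a) = of_real 1"
    by (simp only: of_real_sum mult_conjugate[symmetric] of_real_1)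
  then have "(\<Sum>l<k. (norm (L k l))\<^sup>2) + (\<eta> k)\<^sup>2 = 1"
    unfolding of_real_eq_iff by (simp add: eta)
  moreover have "psum (\<lambda>j. - (L k j / of_real (\<eta> k))) k = 1 + (\<Sum>l<k. (norm (L k l))\<^sup>2) / (\<eta> k)\<^sup>2"
    by (simp add: psum_def norm_divide power_divide sum_divide_distrib)
  ultimately have "psum (\<lambda>j. - (L k j / of_real (\<eta> k))) k = (1 / \<eta> k)\<^sup>2"
    using eta(1) by (simp add: field_simps)
  also have "1 / \<eta> k = entry_minor (Suc k) k x"
    unfolding entry_minor_def gram_minor_cholesky[OF L le_SucI[OF le_refl]] using d eta(1)
    by (simp add: field_simps)
  finally show ?thesis .
qed

section \<open>Induction on the size of the matrix\<close>

text \<open>The size is k + 2, so k counts the free entries of the last column. Index j stands for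
  Lambda_(j+1), and the factor with exponent \<delta> belongs to the last fundamental
  weight.\<close>

definition minor_weight :: "nat \<Rightarrow> real \<Rightarrow> real \<Rightarrow> (nat \<times> nat \<Rightarrow> 'a::conj_normed_field) \<Rightarrow> real" where
  "minor_weight k \<epsilon> \<delta> x =
    (\<Prod>j<k. entry_minor (Suc (Suc k)) (Suc j) x powr - (real DIM('a) * (1 - \<epsilon>))) *
    entry_minor (Suc (Suc k)) (Suc k) x powr - \<delta>"

lemma minor_weight_measurable:
  "minor_weight k \<epsilon> \<delta> \<in> borel_measurable (Pi\<^sub>M (free_entries (Suc (Suc k))) (\<lambda>_. lborel :: 'a::conj_normed_field measure))"
proof -
  have "(\<lambda>x. \<Prod>j<k. entry_minor (Suc (Suc k)) (Suc j) x powr - (real DIM('a) * (1 - \<epsilon>))) \<in>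
      borel_measurable (Pi\<^sub>M (free_entries (Suc (Suc k))) (\<lambda>_. lborel :: 'a measure))"
    by (intro borel_measurable_prod powr_real_measurable entry_minor_measurable) auto
  moreover have "(\<lambda>x. entry_minor (Suc (Suc k)) (Suc k) x powr - \<delta>) \<in>
      borel_measurable (Pi\<^sub>M (free_entries (Suc (Suc k))) (\<lambda>_. lborel :: 'a measure))"
    by (intro powr_real_measurable entry_minor_measurable) auto
  ultimately show ?thesis unfolding minor_weight_def by (rule borel_measurable_times)
qed

lemma minor_weight_mono:
  assumes "\<epsilon> \<le> \<epsilon>'" "\<delta>' \<le> \<delta>"
  shows "minor_weight k \<epsilon> \<delta> (x :: _ \<Rightarrow> 'a::conj_normed_field) \<le> minor_weight k \<epsilon>' \<delta>' x"
  unfolding minor_weight_def using assms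
  by (intro mult_mono prod_mono conjI powr_mono entry_minor_ge_1 prod_nonneg) auto

lemma free_entries_Suc_Suc:
  "free_entries (Suc (Suc k)) = free_entries (Suc k) \<union> (\<lambda>i. (i, Suc k)) ` {..<k}"
  "free_entries (Suc k) \<inter> (\<lambda>i. (i, Suc k)) ` {..<k} = {}"
  by (auto simp: free_entries_def less_Suc_eq)

lemma finite_free_entries: "finite (free_entries n)"
  by (rule finite_subset[of _ "{..<n} \<times> {..<n}"]) (auto simp: free_entries_def)

text \<open>The estimate is assumed for all b because b comes from the Cholesky factor of the
  smaller matrix x; uniformity makes C and \<gamma> independent of x. The Jacobian supplies the
  power DIM('a) of the k-th minor of x, and the decay in psum b k lowers it by 2 * \<gamma>.\<close>

lemma last_column_integral:
  fixes x :: "nat \<times> nat \<Rightarrow> 'a::conj_normed_field" and k :: nat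
  defines "J \<equiv> (\<lambda>i. (i, Suc k)) ` {..<k}"
  assumes x: "x \<in> space (Pi\<^sub>M (free_entries (Suc k)) (\<lambda>_. lborel))"
    and bound: "\<And>b :: nat \<Rightarrow> 'a.
      (\<integral>\<^sup>+u. ennreal ((\<Prod>j<k. psum u (Suc j) powr - (real DIM('a) / 2 * (1 - \<epsilon>))) *
          psum (u(k := \<Sum>j<k. b j * u j)) (Suc k) powr - (\<delta> / 2)) \<partial>Pi\<^sub>M {..<k} (\<lambda>_. lborel))
        \<le> ennreal (C * psum b k powr - \<gamma>)"
    and C: "0 \<le> C"
  shows "(\<integral>\<^sup>+y. ennreal (minor_weight k \<epsilon> \<delta> (merge (free_entries (Suc k)) J (x, y))) \<partial>Pi\<^sub>M J (\<lambda>_. lborel))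
    \<le> ennreal (C * ((\<Prod>j<k. entry_minor (Suc k) (Suc j) x powr - (real DIM('a) * (1 - \<epsilon>))) *
        entry_minor (Suc k) k x powr (real DIM('a) - 2 * \<gamma>)))"
proof -
  let ?v = "\<lambda>p q. of_entries (Suc k) x $$ (p, q)"
  define d where "d = real DIM('a)"
  define I where "I = free_entries (Suc k)"
  have IJ: "I \<union> J = free_entries (Suc (Suc k))" "I \<inter> J = {}"
    using free_entries_Suc_Suc[of k] by (auto simp: I_def J_def)
  obtain L \<eta> where L: "cholesky (Suc k) ?v L \<eta>" and det1: "(\<Prod>l<Suc k. \<eta> l) = 1"
    using cholesky_exists[of "Suc k" ?v] of_entries_unip[of "Suc k" x] by (metis unip_upper_iff)
  have eta: "0 < \<eta> i" "L i i = of_real (\<eta> i)" if "i < Suc k" for i using L that by (auto simp: cholesky_def)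
  define E where "E i = entry_minor (Suc k) i x" for i
  have E: "E i = (\<Prod>l<i. \<eta> l)" if "i \<le> Suc k" for i
    unfolding E_def entry_minor_def by (rule gram_minor_cholesky[OF L that])
  have E1: "1 \<le> E i" if "i \<le> Suc k" for i
    unfolding E_def by (rule entry_minor_ge_1[OF that])
  define b where "b j = - (L k j / of_real (\<eta> k))" for j
  define Q where "Q = (\<Prod>j<k. E (Suc j) powr - (d * (1 - \<epsilon>)))"
  have Q: "0 \<le> Q" by (simp add: Q_def prod_nonneg)
  define T where "T u = (\<lambda>q\<in>J. \<Sum>j<Suc (fst q). L (fst q) j * u j)" for u
  define G where "G u = (\<Prod>j<k. psum u (Suc j) powr - (d / 2 * (1 - \<epsilon>))) *
    psum (u(k := \<Sum>j<k. b j * u j)) (Suc k) powr - (\<delta> / 2)" for u :: "nat \<Rightarrow> 'a"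
  \<comment> \<open>The substitution separates the variables: Q collects the minors of x and G
    depends on u and b only. Exponents of psum are halved because the new minors contain its square
    root.\<close>
  have weight: "minor_weight k \<epsilon> \<delta> (merge I J (x, T u)) = Q * G u" for u
  proof -
    have em: "entry_minor (Suc (Suc k)) i (merge I J (x, T u)) =
      E i * sqrt (psum (u(k := \<Sum>j<k. b j * u j)) i)" if "i \<le> Suc k" for i
      unfolding E[OF that] b_def using that
      by (intro entry_minor_Suc[OF L])
         (auto simp: I_def[symmetric] T_def J_def merge_def, auto simp: I_def free_entries_def)
    have pc: "psum (u(k := \<Sum>j<k. b j * u j)) (Suc j) = psum u (Suc j)" if "j < k" for j
      using that by (intro psum_cong) auto
    \<comment> \<open>The full minor of x is 1, so the factor with exponent \<delta> passes entirely
      into G.\<close>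
    have last: "E (Suc k) = 1" using E[of "Suc k"] det1 by simp
    have root: "(e * sqrt h) powr - s = e powr - s * h powr - (s / 2)" if "1 \<le> e" "0 < h" for e h s :: real
      using that by (simp add: powr_mult powr_half_sqrt[symmetric] powr_powr)
    have "(\<Prod>j<k. entry_minor (Suc (Suc k)) (Suc j) (merge I J (x, T u)) powr - (d * (1 - \<epsilon>))) =
      (\<Prod>j<k. E (Suc j) powr - (d * (1 - \<epsilon>)) * psum u (Suc j) powr - (d / 2 * (1 - \<epsilon>)))"
    proof (rule prod.cong)
      fix j assume "j \<in> {..<k}"
      then have j: "j < k" by simp
      show "entry_minor (Suc (Suc k)) (Suc j) (merge I J (x, T u)) powr - (d * (1 - \<epsilon>)) =
        E (Suc j) powr - (d * (1 - \<epsilon>)) * psum u (Suc j) powr - (d / 2 * (1 - \<epsilon>))"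
        using j by (simp only: em pc Suc_leI less_SucI less_imp_le_nat Suc_le_mono root[OF E1 psum_pos]) simp
    qed simp
    then show ?thesis
      unfolding minor_weight_def d_def[symmetric] em[OF le_refl] last Q_def G_def prod.distrib
      by (simp only: root[OF order_refl psum_pos]) (simp only: powr_one_eq_one mult.assoc mult_1_left)
  qed
  have Gm: "(\<lambda>u. ennreal (G u)) \<in> borel_measurable (Pi\<^sub>M {..<k} (\<lambda>_. lborel))"
  proof -
    let ?P = "Pi\<^sub>M {..<k} (\<lambda>_. lborel :: 'a measure)"
    have comp: "(\<lambda>u. u l) \<in> borel_measurable ?P" if "l < k" for l
      using measurable_component_singleton[of l "{..<k}" "\<lambda>_. lborel :: 'a measure"] that by simp
    have ps: "(\<lambda>u. psum u i) \<in> borel_measurable ?P" if "i \<le> k" for i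
      unfolding psum_def using that
      by (intro borel_measurable_add borel_measurable_sum borel_measurable_power comp
          measurable_compose[OF comp borel_measurable_norm]) auto
    have "(\<lambda>u. \<Sum>j<k. b j * u j) \<in> borel_measurable ?P"
      by (intro borel_measurable_sum borel_measurable_times comp) auto
    then have "(\<lambda>u. psum u k + (norm (\<Sum>j<k. b j * u j))\<^sup>2) \<in> borel_measurable ?P"
      by (intro borel_measurable_add ps borel_measurable_power measurable_compose[OF _ borel_measurable_norm]) auto
    moreover have "psum (u(k := z)) (Suc k) = psum u k + (norm z)\<^sup>2" for u :: "nat \<Rightarrow> 'a" and z
      by (simp add: psum_def)
    ultimately show ?thesis
      unfolding G_def
      by (intro measurable_compose[OF _ measurable_ennreal] borel_measurable_times borel_measurable_prod
          powr_real_measurable ps) (simp_all del: fun_upd_apply)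
  qed
  have W: "(\<lambda>y. ennreal (minor_weight k \<epsilon> \<delta> (merge I J (x, y)))) \<in> borel_measurable (Pi\<^sub>M J (\<lambda>_. lborel))"
    using x by (intro measurable_compose[OF measurable_compose[OF measurable_Pair1' measurable_merge]
          measurable_compose[OF minor_weight_measurable[of k \<epsilon> \<delta>, folded IJ(1)] measurable_ennreal]])
       (simp add: I_def)
  have "(\<integral>\<^sup>+y. ennreal (minor_weight k \<epsilon> \<delta> (merge I J (x, y))) \<partial>Pi\<^sub>M J (\<lambda>_. lborel)) =
    ennreal ((\<Prod>i<k. \<eta> i) ^ DIM('a)) *
    (\<integral>\<^sup>+u. ennreal (minor_weight k \<epsilon> \<delta> (merge I J (x, T u))) \<partial>Pi\<^sub>M {..<k} (\<lambda>_. lborel))"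
    unfolding J_def T_def using W
    by (intro triangular_substitution) (auto simp: eta J_def)
  also have "\<dots> = ennreal (E k powr d) * (ennreal Q * (\<integral>\<^sup>+u. ennreal (G u) \<partial>Pi\<^sub>M {..<k} (\<lambda>_. lborel)))"
    unfolding weight using E1[of k] Gm Q
    by (simp add: E[symmetric] d_def powr_realpow nn_integral_cmult ennreal_mult')
  also have "\<dots> \<le> ennreal (E k powr d) * (ennreal Q * ennreal (C * psum b k powr - \<gamma>))"
    unfolding G_def d_def by (intro mult_left_mono bound) auto
  also have "\<dots> = ennreal (C * (Q * (E k powr d * psum b k powr - \<gamma>)))"
    using Q C by (simp add: ennreal_mult'[symmetric] mult_ac)
  also have "E k powr d * psum b k powr - \<gamma> = E k powr (d - 2 * \<gamma>)"
  proof -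
    have "psum b k = E k powr 2"
      using psum_last_row[OF L det1] E1[of k] unfolding b_def E_def by (simp add: powr_numeral)
    then show ?thesis by (simp only: powr_powr powr_add[symmetric]) simp
  qed
  finally show ?thesis by (simp add: I_def Q_def E_def d_def)
qed

text \<open>Integrating out the last column bounds the integral by one of the same kind for the
  smaller size, with the gain \<gamma> in the role of \<delta>; hence \<delta> is arbitrary in the
  induction.\<close>

lemma minor_weight_integral_finite:
  assumes "\<delta> > 0"
  shows "\<exists>\<epsilon>>0. (\<integral>\<^sup>+x. ennreal (minor_weight k \<epsilon> \<delta> x)
    \<partial>Pi\<^sub>M (free_entries (Suc (Suc k))) (\<lambda>_. lborel :: 'a::conj_normed_field measure)) < \<infinity>"
  using assms
proof (induction k arbitrary: \<delta>)
  case 0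
  \<comment> \<open>For size 2 the group is trivial and the integral is over a single point.\<close>
  have "free_entries (Suc (Suc 0)) = {}" by (auto simp: free_entries_def)
  then show ?case
    by (intro exI[of _ 1]) (simp add: PiM_empty nn_integral_count_space_finite)
next
  case (Suc k')
  let ?k = "Suc k'"
  define d where "d = real DIM('a)"
  have d: "d > 0" by (simp add: d_def)
  define J where "J = (\<lambda>i. (i, Suc ?k)) ` {..<?k}"
  obtain \<epsilon>\<^sub>0 \<gamma> C where pos: "0 < \<epsilon>\<^sub>0" "0 < \<gamma>" "0 \<le> C"
    and bound: "\<And>\<epsilon> (b :: nat \<Rightarrow> 'a). \<epsilon> \<le> \<epsilon>\<^sub>0 \<Longrightarrow>
      (\<integral>\<^sup>+u. ennreal ((\<Prod>j<?k. psum u (Suc j) powr - (real DIM('a) / 2 * (1 - \<epsilon>))) *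
          psum (u(?k := \<Sum>j<?k. b j * u j)) (Suc ?k) powr - (\<delta> / 2)) \<partial>Pi\<^sub>M {..<?k} (\<lambda>_. lborel))
        \<le> ennreal (C * psum b ?k powr - \<gamma>)"
    by (rule psum_product_integral[OF Suc.prems zero_less_Suc[of k'], where ?'a = 'a]) (rule that)
  obtain \<epsilon>' where \<epsilon>': "\<epsilon>' > 0" and fin: "(\<integral>\<^sup>+x. ennreal (minor_weight k' \<epsilon>' \<gamma> x)
    \<partial>Pi\<^sub>M (free_entries (Suc ?k)) (\<lambda>_. lborel :: 'a measure)) < \<infinity>"
    using Suc.IH[OF pos(2)] by blast
  \<comment> \<open>The third bound gives 2 * \<gamma> - d * \<epsilon> >= \<gamma>, so that half of
    the gain survives the loss caused by \<epsilon>.\<close>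
  define \<epsilon> where "\<epsilon> = min \<epsilon>\<^sub>0 (min \<epsilon>' (\<gamma> / d))"
  have "\<epsilon> \<le> \<gamma> / d" by (simp add: \<epsilon>_def)
  then have \<epsilon>: "0 < \<epsilon>" "\<epsilon> \<le> \<epsilon>\<^sub>0" "\<epsilon> \<le> \<epsilon>'" "d * \<epsilon> \<le> \<gamma>"
    using pos \<epsilon>' d by (auto simp: \<epsilon>_def pos_le_divide_eq mult.commute)
  have "(\<integral>\<^sup>+x. ennreal (minor_weight ?k \<epsilon> \<delta> x) \<partial>Pi\<^sub>M (free_entries (Suc (Suc ?k))) (\<lambda>_. lborel :: 'a measure)) =
    (\<integral>\<^sup>+x. \<integral>\<^sup>+y. ennreal (minor_weight ?k \<epsilon> \<delta> (merge (free_entries (Suc ?k)) J (x, y))) \<partial>Pi\<^sub>M J (\<lambda>_. lborel)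
      \<partial>Pi\<^sub>M (free_entries (Suc ?k)) (\<lambda>_. lborel :: 'a measure))"
    unfolding J_def free_entries_Suc_Suc(1)[of ?k]
    by (rule lborel_product.product_nn_integral_fold[OF free_entries_Suc_Suc(2) finite_free_entries])
       (auto simp: free_entries_Suc_Suc(1)[of ?k, symmetric]
         intro!: measurable_compose[OF minor_weight_measurable measurable_ennreal])
  also have "\<dots> \<le> (\<integral>\<^sup>+x. ennreal C * ennreal (minor_weight k' \<epsilon>' \<gamma> x)
      \<partial>Pi\<^sub>M (free_entries (Suc ?k)) (\<lambda>_. lborel :: 'a measure))"
  proof (rule nn_integral_mono)
    fix x assume x: "x \<in> space (Pi\<^sub>M (free_entries (Suc ?k)) (\<lambda>_. lborel :: 'a measure))"
    let ?E = "\<lambda>i. entry_minor (Suc ?k) i x"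
    have E1: "1 \<le> ?E ?k" by (intro entry_minor_ge_1) simp
    have "(\<integral>\<^sup>+y. ennreal (minor_weight ?k \<epsilon> \<delta> (merge (free_entries (Suc ?k)) J (x, y))) \<partial>Pi\<^sub>M J (\<lambda>_. lborel))
      \<le> ennreal (C * ((\<Prod>j<?k. ?E (Suc j) powr - (d * (1 - \<epsilon>))) * ?E ?k powr (d - 2 * \<gamma>)))"
      unfolding J_def d_def by (rule last_column_integral[OF x bound[OF \<epsilon>(2)] pos(3)])
    \<comment> \<open>The factor j = k' concerns the last character of the smaller matrix. Its
      exponent - d * (1 - \<epsilon>) cancels the Jacobian's d except for d * \<epsilon>.\<close>
    also have "(\<Prod>j<?k. ?E (Suc j) powr - (d * (1 - \<epsilon>))) * ?E ?k powr (d - 2 * \<gamma>) =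
      (\<Prod>j<k'. ?E (Suc j) powr - (d * (1 - \<epsilon>))) * ?E ?k powr - (2 * \<gamma> - d * \<epsilon>)"
      by (simp add: mult.assoc powr_add[symmetric] algebra_simps)
    also have "\<dots> = minor_weight k' \<epsilon> (2 * \<gamma> - d * \<epsilon>) x"
      by (simp add: minor_weight_def d_def)
    also have "ennreal (C * minor_weight k' \<epsilon> (2 * \<gamma> - d * \<epsilon>) x) \<le> ennreal (C * minor_weight k' \<epsilon>' \<gamma> x)"
      using \<epsilon> pos by (intro ennreal_leI mult_left_mono minor_weight_mono) auto
    finally show "(\<integral>\<^sup>+y. ennreal (minor_weight ?k \<epsilon> \<delta> (merge (free_entries (Suc ?k)) J (x, y))) \<partial>Pi\<^sub>M J (\<lambda>_. lborel))
      \<le> ennreal C * ennreal (minor_weight k' \<epsilon>' \<gamma> x)"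
      using pos by (simp add: ennreal_mult')
  qed
  also have "\<dots> = ennreal C * (\<integral>\<^sup>+x. ennreal (minor_weight k' \<epsilon>' \<gamma> x)
      \<partial>Pi\<^sub>M (free_entries (Suc ?k)) (\<lambda>_. lborel :: 'a measure))"
    by (intro nn_integral_cmult measurable_compose[OF minor_weight_measurable measurable_ennreal])
  also have "\<dots> < \<infinity>" using fin by (simp add: ennreal_mult_less_top)
  finally show ?case using \<epsilon>(1) by blast
qed

section \<open>The logarithmic factor and the transfer to the measure on the group\<close>

lemma one_plus_ln_powr_le:
  fixes e r :: real
  assumes "e > 0"
  obtains K where "0 \<le> K" "\<And>R :: real. 1 \<le> R \<Longrightarrow> (1 + ln R) powr r \<le> K * R powr e"
proof -
  \<comment> \<open>Since 1 + ln R >= 1, the exponent may be raised to a positive one, for which a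
    small power of R dominates the logarithm.\<close>
  define q where "q = max r 1"
  have q: "q > 0" "r \<le> q" by (auto simp: q_def)
  define s where "s = e / q"
  have s: "s > 0" using assms q by (simp add: s_def)
  have "(1 + ln R) powr r \<le> (1 + 1 / s) powr q * R powr e" if R: "1 \<le> R" for R :: real
  proof -
    have "1 \<le> R powr s" using R s by (simp add: ge_one_powr_ge_zero)
    then have "1 + ln R \<le> R powr s + R powr s / s"
      using ln_powr_bound[OF R s] by simp
    also have "\<dots> = (1 + 1 / s) * R powr s" by (simp add: algebra_simps)
    finally have le: "1 + ln R \<le> (1 + 1 / s) * R powr s" .
    have "(1 + ln R) powr r \<le> (1 + ln R) powr q" using R q by (intro powr_mono) auto
    also have "\<dots> \<le> ((1 + 1 / s) * R powr s) powr q" using le R q by (intro powr_mono2) auto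
    also have "\<dots> = (1 + 1 / s) powr q * R powr e" using s q by (simp add: powr_mult powr_powr s_def)
    finally show ?thesis .
  qed
  then show thesis by (intro that[of "(1 + 1 / s) powr q"]) auto
qed

text \<open>On the commutator subgroup \<open>entries\<close> inverts \<open>of_entries\<close>, so
  measurability in the free entries passes back to the group and integrability can be read off
  before the transport.\<close>

lemma integrable_haar_commN_iff:
  fixes f :: "'a::conj_normed_field mat \<Rightarrow> real"
  assumes f: "(\<lambda>x. f (of_entries n x)) \<in> borel_measurable (Pi\<^sub>M (free_entries n) (\<lambda>_. lborel))"
  shows "integrable (haar_commN n) f \<longleftrightarrow>
    integrable (Pi\<^sub>M (free_entries n) (\<lambda>_. lborel)) (\<lambda>x. f (of_entries n x))"
proof -
  let ?L = "Pi\<^sub>M (free_entries n) (\<lambda>_. lborel :: 'a measure)"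
  let ?V = "vimage_algebra (commN n) (entries n) ?L"
  have "entries n \<in> ?V \<rightarrow>\<^sub>M ?L"
    by (rule measurable_vimage_algebra1) (auto simp: entries_def space_PiM)
  from measurable_compose[OF this f]
  have "f \<in> borel_measurable ?V"
    by (rule measurable_cong[THEN iffD1, rotated]) (simp add: of_entries_entries)
  then show ?thesis
    unfolding haar_commN_def Let_def by (rule integrable_distr_eq[OF of_entries_measurable])
qed

text \<open>The positive power \<alpha> * DIM('a) affects only the last minor and leaves it a
  negative exponent because \<alpha> < 1; all other minors keep nearly the exponent of rho. This is
  the situation of \<open>minor_weight\<close>.\<close>

lemma integrable_iwasawa_weight:
  fixes \<alpha> r :: real
  assumes n: "3 \<le> n" and \<alpha>: "\<alpha> < 1"
  shows "integrable (haar_commN n) (\<lambda>v :: 'a::conj_normed_field mat.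
           let a = iwasawa_a n v in
             rho n a powr (- 1) * Lambda (n - 1) a powr (\<alpha> * real DIM('a))
               * (1 + ln (rho n a)) powr r)"
proof -
  let ?L = "Pi\<^sub>M (free_entries n) (\<lambda>_. lborel :: 'a measure)"
  define k where "k = n - 2"
  have nk: "n = Suc (Suc k)" using n by (simp add: k_def)
  define d where "d = real DIM('a)"
  have d: "d > 0" by (simp add: d_def)
  define E where "E i x = entry_minor n i x" for i and x :: "nat \<times> nat \<Rightarrow> 'a"
  have E1: "1 \<le> E i x" if "i \<le> n" for i x unfolding E_def by (rule entry_minor_ge_1[OF that])
  have [measurable]: "E i \<in> borel_measurable ?L" if "i \<le> n" for i
    unfolding E_def using entry_minor_measurable[OF that] by simp
  define R where "R x = (\<Prod>i=1..<n. E i x ^ DIM('a))" for x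
  have R1: "1 \<le> R x" for x
    unfolding R_def by (intro prod_ge_1 one_le_power E1) auto
  have [measurable]: "R \<in> borel_measurable ?L"
    unfolding R_def by (intro borel_measurable_prod borel_measurable_power) auto
  define g where "g x = R x powr (- 1) * E (n - 1) x powr (\<alpha> * d) * (1 + ln (R x)) powr r" for x
  have gm: "g \<in> borel_measurable ?L"
    unfolding g_def by (intro borel_measurable_times powr_real_measurable borel_measurable_add borel_measurable_ln) auto
  \<comment> \<open>The last minor has the exponent - d * (1 - \<alpha>). Half of this is kept as
    \<delta> and the other half is reserved for the logarithm.\<close>
  define \<delta> where "\<delta> = d * (1 - \<alpha>) / 2"
  have \<delta>: "\<delta> > 0" using d \<alpha> by (simp add: \<delta>_def)
  obtain \<epsilon> where \<epsilon>: "\<epsilon> > 0" and fin: "(\<integral>\<^sup>+x. ennreal (minor_weight k \<epsilon> \<delta> x) \<partial>?L) < \<infinity>"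
    using minor_weight_integral_finite[OF \<delta>, of k] unfolding nk by blast
  \<comment> \<open>The logarithm costs a factor R powr e, that is, d * e in every exponent: e <=
    \<epsilon> is what the inner minors can bear, and the second bound what the last one
    can.\<close>
  define e where "e = min \<epsilon> ((1 - \<alpha>) / 2)"
  have e: "0 < e" "e \<le> \<epsilon>" "e \<le> (1 - \<alpha>) / 2" using \<epsilon> \<alpha> by (simp_all add: e_def min.coboundedI2 del: le_divide_eq_numeral1)
  obtain K where K: "0 \<le> K" "\<And>R :: real. 1 \<le> R \<Longrightarrow> (1 + ln R) powr r \<le> K * R powr e"
    using one_plus_ln_powr_le[OF e(1)] by blast
  have bound: "g x \<le> K * minor_weight k \<epsilon> \<delta> x" for x
  proof -
    have "g x \<le> R x powr (- 1) * E (n - 1) x powr (\<alpha> * d) * (K * R x powr e)"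
      unfolding g_def by (intro mult_left_mono K R1) auto
    also have "\<dots> = K * (R x powr - (1 - e) * E (Suc k) x powr (\<alpha> * d))"
      by (simp add: nk powr_diff powr_minus field_simps)
    also have "R x powr - (1 - e) = (\<Prod>i=1..<n. E i x powr - (d * (1 - e)))"
    proof -
      have "E i x ^ DIM('a) = E i x powr d" if "i < n" for i
        using E1[of i x] that by (simp add: d_def powr_realpow)
      then have "R x = (\<Prod>i=1..<n. E i x powr d)" unfolding R_def by (intro prod.cong) auto
      then show ?thesis by (simp add: prod_powr_distrib powr_powr algebra_simps)
    qed
    also have "\<dots> = (\<Prod>j<Suc k. E (Suc j) x powr - (d * (1 - e)))"
      unfolding nk by (rule prod.reindex_bij_witness[of _ Suc "\<lambda>i. i - 1"]) auto
    also have "\<dots> * E (Suc k) x powr (\<alpha> * d) = minor_weight k e (d * (1 - e) - \<alpha> * d) x"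
      by (simp add: minor_weight_def d_def E_def nk powr_add[symmetric] mult.assoc)
    also have "K * \<dots> \<le> K * minor_weight k \<epsilon> \<delta> x"
    proof (intro mult_left_mono minor_weight_mono)
      have "d * e \<le> d * ((1 - \<alpha>) / 2)" using e d by (intro mult_left_mono) auto
      then show "\<delta> \<le> d * (1 - e) - \<alpha> * d" by (simp add: \<delta>_def field_simps)
    qed (use e K in auto)
    finally show ?thesis .
  qed
  have g0: "0 \<le> g x" for x by (simp add: g_def)
  have "(\<integral>\<^sup>+x. ennreal (norm (g x)) \<partial>?L) \<le> (\<integral>\<^sup>+x. ennreal K * ennreal (minor_weight k \<epsilon> \<delta> x) \<partial>?L)"
    using bound g0 K(1) by (intro nn_integral_mono) (simp add: ennreal_mult'[symmetric] ennreal_leI)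
  also have "\<dots> = ennreal K * (\<integral>\<^sup>+x. ennreal (minor_weight k \<epsilon> \<delta> x) \<partial>?L)"
    unfolding nk by (intro nn_integral_cmult measurable_compose[OF minor_weight_measurable measurable_ennreal])
  also have "\<dots> < \<infinity>" using fin by (simp add: ennreal_mult_less_top)
  finally have "integrable ?L g" using gm by (intro integrableI_bounded)
  moreover have "g = (\<lambda>x. let a = iwasawa_a n (of_entries n x) in
      rho n a powr (- 1) * Lambda (n - 1) a powr (\<alpha> * real DIM('a)) * (1 + ln (rho n a)) powr r)"
    by (simp add: fun_eq_iff Let_def g_def R_def E_def entry_minor_def d_def iwasawa_characters[OF of_entries_unip])
  ultimately show ?thesis
    using gm by (subst integrable_haar_commN_iff) simp_all
qed

theorem theorem9:
  fixes n :: nat and \<alpha> r :: real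
  assumes "3 \<le> n" and "0 \<le> \<alpha>" and "\<alpha> < 1"
  shows "integrable (haar_commN n) (\<lambda>v :: real mat.
           let a = iwasawa_a n v in
             rho n a powr (- 1) * Lambda (n - 1) a powr (\<alpha> * real DIM(real))
               * (1 + ln (rho n a)) powr r)
       \<and> integrable (haar_commN n) (\<lambda>v :: complex mat.
           let a = iwasawa_a n v in
             rho n a powr (- 1) * Lambda (n - 1) a powr (\<alpha> * real DIM(complex))
               * (1 + ln (rho n a)) powr r)"
  using assms(1,3) by (intro conjI integrable_iwasawa_weight)

end
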